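(* Let $R$ be a finite proper nearfield, let $n\ge 1$, and let $T$ be an $R$-subgroup of $R^n$ with $\dim(T)=\ell$. Then $$\operatorname{seed}(T)=\min\left\{k\in\mathbb{Z}_{\ge 0}:\ \frac{|R|^k-1}{|R|-1}\ge \ell\right\}.$$ In particular, if $\ell\ge 1$, then $$\log_{|R|}\ell\le \operatorname{seed}(T)\le 2+\log_{|R|}\ell .$$
   Context: A (left) nearfield is a set $R$ with two operations $+,\cdot$ such that $(R,+)$ is a group (it is automatically abelian), multiplication is associative, $a(b+c)=ab+ac$ for all $a,b,c\in R$, $0\cdot r=r\cdot 0=0$ for all $r\in R$, and $R\setminus\{0\}$ is a group under multiplication. A nearfield $R$ is proper if it is not a skewfield, i.e. there exist $a,b,c\in R$ with $(a+b)c\ne ac+bc$. $R^n$ carries coordinatewise addition and the right scalar multiplication $(v_1,\ldots,v_n)r=(v_1r,\ldots,v_nr)$ for $r\in R$. An $R$-subgroup of $R^n$ is a subgroup $H$ of $(R^n,+)$ such that $hr\in H$ for all $h\in H$, $r\in R$. For $V\subseteq R^n$, $\operatorname{gen}(V)$ denotes the intersection of all $R$-subgroups of $R^n$ containing $V$ (so $\operatorname{gen}(\emptyset)=\{0\}$). A finite set $V$ is a seed set of an $R$-subgroup $T$ if $\operatorname{gen}(V)=T$; the seed number $\operatorname{seed}(T)$ is the cardinality of a smallest seed set of $T$. The support of $u\in R^n$ is $\operatorname{supp}(u)=\{1\le i\le n:u_i\neq 0\}$, and $uR=\{ur:r\in R\}$. When $R$ is proper, every $R$-subgroup $T$ of $R^n$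 can be written as an internal direct sum $T=\bigoplus_{i=1}^\ell u_iR$ with $u_1,\ldots,u_\ell\in R^n$ nonzero vectors with mutually disjoint supports ($\ell\ge 0$), and the number $\ell$ is uniquely determined by $T$; the dimension of $T$ is $\dim(T)=\ell$. *)

theory Defs
  imports
    Complex_Main
    "HOL-Library.Disjoint_Sets"
    "HOL-Algebra.Multiplicative_Group"
    "HOL-Algebra.Product_Groups"
begin

text \<open>
  Left nearfields. Commutativity of addition is not assumed; it follows from the axioms.
\<close>

locale nearfield =
  fixes R :: "('a, 'b) ring_scheme" (structure)
  assumes add_group: "group (add_monoid R)"
    and m_closed: "\<lbrakk>a \<in> carrier R; b \<in> carrier R\<rbrakk> \<Longrightarrow> a \<otimes> b \<in> carrier R"
    and m_assoc: "\<lbrakk>a \<in> carrier R; b \<in> carrier R; c \<in> carrier R\<rbrakk>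
      \<Longrightarrow> (a \<otimes> b) \<otimes> c = a \<otimes> (b \<otimes> c)"
    and left_distrib: "\<lbrakk>a \<in> carrier R; b \<in> carrier R; c \<in> carrier R\<rbrakk>
      \<Longrightarrow> a \<otimes> (b \<oplus> c) = a \<otimes> b \<oplus> a \<otimes> c"
    and zero_mult: "r \<in> carrier R \<Longrightarrow> \<zero> \<otimes> r = \<zero>"
    and mult_zero: "r \<in> carrier R \<Longrightarrow> r \<otimes> \<zero> = \<zero>"
    and mult_group: "group (mult_of R)"

locale proper_nearfield = nearfield +
  assumes not_right_distrib:
    "\<exists>a \<in> carrier R. \<exists>b \<in> carrier R. \<exists>c \<in> carrier R.
      (a \<oplus> b) \<otimes> c \<noteq> a \<otimes> c \<oplus> b \<otimes> c"

text \<open>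
  The additive group $R^n$. Vectors are extensional functions on \<open>{1..n}\<close>. The group is
  written multiplicatively as an HOL-Algebra group, so its \<open>\<one>\<close> is the zero vector.
\<close>

definition nf_vec :: "('a, 'b) ring_scheme \<Rightarrow> nat \<Rightarrow> (nat \<Rightarrow> 'a) monoid" where
  "nf_vec R n = product_group {1..n} (\<lambda>_. add_monoid R)"

definition nf_scale :: "('a, 'b) ring_scheme \<Rightarrow> nat \<Rightarrow> (nat \<Rightarrow> 'a) \<Rightarrow> 'a \<Rightarrow> (nat \<Rightarrow> 'a)" where
  "nf_scale R n v r = (\<lambda>i\<in>{1..n}. v i \<otimes>\<^bsub>R\<^esub> r)"

definition nf_subgroup :: "('a, 'b) ring_scheme \<Rightarrow> nat \<Rightarrow> (nat \<Rightarrow> 'a) set \<Rightarrow> bool" where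
  "nf_subgroup R n H \<longleftrightarrow>
     subgroup H (nf_vec R n) \<and> (\<forall>h\<in>H. \<forall>r\<in>carrier R. nf_scale R n h r \<in> H)"

definition nf_gen :: "('a, 'b) ring_scheme \<Rightarrow> nat \<Rightarrow> (nat \<Rightarrow> 'a) set \<Rightarrow> (nat \<Rightarrow> 'a) set" where
  "nf_gen R n V = \<Inter> {H. nf_subgroup R n H \<and> V \<subseteq> H}"

definition seed_set ::
    "('a, 'b) ring_scheme \<Rightarrow> nat \<Rightarrow> (nat \<Rightarrow> 'a) set \<Rightarrow> (nat \<Rightarrow> 'a) set \<Rightarrow> bool" where
  "seed_set R n T V \<longleftrightarrow> finite V \<and> V \<subseteq> carrier (nf_vec R n) \<and> nf_gen R n V = T"

definition seed_number :: "('a, 'b) ring_scheme \<Rightarrow> nat \<Rightarrow> (nat \<Rightarrow> 'a) set \<Rightarrow> nat" where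
  "seed_number R n T = (LEAST k. \<exists>V. seed_set R n T V \<and> card V = k)"

definition nf_supp :: "('a, 'b) ring_scheme \<Rightarrow> nat \<Rightarrow> (nat \<Rightarrow> 'a) \<Rightarrow> nat set" where
  "nf_supp R n u = {i\<in>{1..n}. u i \<noteq> \<zero>\<^bsub>R\<^esub>}"

definition nf_cyclic :: "('a, 'b) ring_scheme \<Rightarrow> nat \<Rightarrow> (nat \<Rightarrow> 'a) \<Rightarrow> (nat \<Rightarrow> 'a) set" where
  "nf_cyclic R n u = nf_scale R n u ` carrier R"

text \<open>
  For a commutative group \<open>G\<close> (such as $R^n$ here), \<open>T\<close> is the internal direct sum of a finite
  family of subgroups \<open>A i\<close> when every element of \<open>T\<close>, and no other element, is a sum of
  elements of the \<open>A i\<close>, in exactly one way.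
\<close>

definition internal_direct_sum ::
    "('g, 'c) monoid_scheme \<Rightarrow> 'i set \<Rightarrow> ('i \<Rightarrow> 'g set) \<Rightarrow> 'g set \<Rightarrow> bool" where
  "internal_direct_sum G I A T \<longleftrightarrow>
     (\<forall>i\<in>I. subgroup (A i) G) \<and>
     bij_betw (\<lambda>x. finprod G x I) (\<Pi>\<^sub>E i\<in>I. A i) T"

definition has_disjoint_decomposition ::
    "('a, 'b) ring_scheme \<Rightarrow> nat \<Rightarrow> (nat \<Rightarrow> 'a) set \<Rightarrow> nat \<Rightarrow> bool" where
  "has_disjoint_decomposition R n T l \<longleftrightarrow>
     (\<exists>u :: nat \<Rightarrow> nat \<Rightarrow> 'a.
        (\<forall>i\<in>{1..l}. u i \<in> carrier (nf_vec R n) \<and> u i \<noteq> \<one>\<^bsub>nf_vec R n\<^esub>) \<and>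
        disjoint_family_on (\<lambda>i. nf_supp R n (u i)) {1..l} \<and>
        internal_direct_sum (nf_vec R n) {1..l} (\<lambda>i. nf_cyclic R n (u i)) T)"

definition nf_dim :: "('a, 'b) ring_scheme \<Rightarrow> nat \<Rightarrow> (nat \<Rightarrow> 'a) set \<Rightarrow> nat" where
  "nf_dim R n T = (THE l. has_disjoint_decomposition R n T l)"

end

theory Submission
  imports Defs
begin

text \<open>
  Call two coordinates equivalent for an \<open>R\<close>-subgroup \<open>T\<close> if on \<open>T\<close> one is a nonzero left multiple
  of the other. If a coordinate \<open>i\<close> is not identically zero on \<open>T\<close> and \<open>j\<close> is not equivalent to it,
  some element of \<open>T\<close> has \<open>i\<close>-th entry \<open>1\<close> and \<open>j\<close>-th entry \<open>0\<close>. The defect \<open>(x + y) c - x c - y c\<close>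
  of right distributivity vanishes wherever \<open>x\<close> or \<open>y\<close> vanishes, and properness keeps it nonzero at
  \<open>i\<close> for suitable multiples of \<open>x\<close> and \<open>y\<close>, so the zeros for different \<open>j\<close> can be collected in one
  element, supported exactly on the class of \<open>i\<close>. These elements decompose \<open>T\<close>, and \<open>dim T\<close> is the
  number of classes. Equations \<open>h j = s (h i)\<close> persist from \<open>V\<close> to the \<open>R\<close>-subgroup generated by
  \<open>V\<close>; hence \<open>k\<close> vectors generate such a \<open>T\<close> exactly when the classes yield nonzero columns in
  $R^k$, no two of them left multiples of each other, and there are $(|R|^k-1)/(|R|-1)$ nonzero
  vectors up to such multiples.
\<close>

section \<open>Additive commutativity\<close>

text \<open>Every element is its own inverse, and inversion reverses products. This settles the case
  in which \<open>\<one>\<close> is its own negative in the nearfield.\<close>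

lemma (in group) comm_group_if_exponent_two:
  assumes "\<And>x. x \<in> carrier G \<Longrightarrow> x \<otimes> x = \<one>"
  shows "comm_group G"
proof (rule group_comm_groupI)
  fix x y assume xy: "x \<in> carrier G" "y \<in> carrier G"
  have "inv z = z" if "z \<in> carrier G" for z
    using assms that by (simp add: inv_equality)
  then show "x \<otimes> y = y \<otimes> x"
    using xy inv_mult_group[of x y] by simp
qed

text \<open>Finiteness forces \<open>\<phi>\<close> to be the inversion map, and inversion is a
  homomorphism only on a commutative group.\<close>

lemma (in group) comm_group_if_fixed_point_free_involution:
  assumes fin: "finite (carrier G)"
    and hom: "\<phi> \<in> hom G G"
    and invol: "\<And>x. x \<in> carrier G \<Longrightarrow> \<phi> (\<phi> x) = x"
    and fixed: "\<And>x. \<lbrakk>x \<in> carrier G; \<phi> x = x\<rbrakk> \<Longrightarrow> x = \<one>"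
  shows "comm_group G"
proof (rule group_comm_groupI)
  interpret \<phi>: group_hom G G \<phi>
    using hom by unfold_locales auto
  let ?\<psi> = "\<lambda>x. inv x \<otimes> \<phi> x"
  \<comment> \<open>Injectivity of \<open>?\<psi>\<close> and finiteness make every element of the form \<open>?\<psi> x\<close>,
    and \<open>\<phi>\<close> inverts those.\<close>
  have inj: "inj_on ?\<psi> (carrier G)"
  proof (rule inj_onI)
    fix x y assume xy: "x \<in> carrier G" "y \<in> carrier G" and eq: "?\<psi> x = ?\<psi> y"
    \<comment> \<open>Multiplying by \<open>y\<close> on the left and by
      \<open>inv (\<phi> x)\<close> on the right turns equality of the two images into the statement
      that \<open>\<phi>\<close> fixes \<open>y \<otimes> inv x\<close>.\<close>
    have "y \<otimes> inv x \<otimes> \<phi> x = y \<otimes> (inv x \<otimes> \<phi> x)"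
      using xy by (simp add: m_assoc)
    also have "\<dots> = \<phi> y"
      using xy by (simp add: eq m_assoc[symmetric])
    finally have "y \<otimes> inv x \<otimes> \<phi> x \<otimes> inv (\<phi> x) = \<phi> y \<otimes> inv (\<phi> x)"
      by simp
    then have "\<phi> y \<otimes> inv (\<phi> x) = y \<otimes> inv x"
      using xy by (simp add: m_assoc)
    then have "\<phi> (y \<otimes> inv x) = y \<otimes> inv x"
      using xy by simp
    then have "y \<otimes> inv x = \<one>"
      using fixed xy by simp
    then show "x = y"
      using xy by (metis inv_equality inv_closed inv_inv)
  qed
  have "?\<psi> ` carrier G = carrier G"
    by (rule endo_inj_surj[OF fin _ inj]) auto
  then have \<phi>_inv: "\<phi> y = inv y" if y: "y \<in> carrier G" for y
  proof -
    obtain x where x: "x \<in> carrier G" "y = inv x \<otimes> \<phi> x"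
      using y \<open>?\<psi> ` carrier G = carrier G\<close> by blast
    then show ?thesis
      using invol by (simp add: inv_mult_group)
  qed
  fix x y assume xy: "x \<in> carrier G" "y \<in> carrier G"
  have "inv (x \<otimes> y) = inv x \<otimes> inv y"
    using xy \<phi>_inv[of "x \<otimes> y"] \<phi>_inv[of x] \<phi>_inv[of y] by simp
  then have "inv (x \<otimes> y) = inv (y \<otimes> x)"
    using xy by (simp add: inv_mult_group)
  then show "x \<otimes> y = y \<otimes> x"
    using xy by (metis inv_inv m_closed)
qed

locale finite_nearfield = nearfield +
  assumes finite_carrier: "finite (carrier R)"

locale finite_proper_nearfield = finite_nearfield + proper_nearfield

section \<open>Units, inverses and cancellation\<close>

context nearfield
begin

lemma one_carrier [simp]: "\<one> \<in> carrier R" and one_neq_zero [simp]: "\<one> \<noteq> \<zero>"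
  using group.is_monoid[OF mult_group, THEN monoid.one_closed] by auto

lemma l_unit [simp]: "a \<in> carrier R \<Longrightarrow> \<one> \<otimes> a = a"
  and r_unit [simp]: "a \<in> carrier R \<Longrightarrow> a \<otimes> \<one> = a"
  using group.is_monoid[OF mult_group, THEN monoid.l_one, of a]
    group.is_monoid[OF mult_group, THEN monoid.r_one, of a] mult_zero zero_mult
  by (cases "a = \<zero>"; simp)+

lemma mult_nonzero:
  assumes "a \<in> carrier R" "b \<in> carrier R" "a \<noteq> \<zero>" "b \<noteq> \<zero>"
  shows "a \<otimes> b \<noteq> \<zero>"
  using group.is_monoid[OF mult_group, THEN monoid.m_closed, of a b] assms by simp

lemma obtain_inverse:
  assumes "a \<in> carrier R" "a \<noteq> \<zero>"
  obtains b where "b \<in> carrier R" "b \<noteq> \<zero>" "a \<otimes> b = \<one>" "b \<otimes> a = \<one>"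
  using group.inv_closed[OF mult_group, of a] group.r_inv[OF mult_group, of a]
    group.l_inv[OF mult_group, of a] assms by fastforce

lemma mult_right_cancel:
  assumes "a \<in> carrier R" "b \<in> carrier R" "c \<in> carrier R" "c \<noteq> \<zero>" "a \<otimes> c = b \<otimes> c"
  shows "a = b"
proof -
  obtain d where d: "d \<in> carrier R" "c \<otimes> d = \<one>"
    using obtain_inverse assms by blast
  have "a \<otimes> c \<otimes> d = b \<otimes> c \<otimes> d"
    using assms by simp
  then show ?thesis
    using d m_assoc[of a c d] m_assoc[of b c d] assms(1-3) by simp
qed

end

context finite_nearfield
begin

text \<open>Left multiplication by the negative \<open>c\<close> of \<open>\<one>\<close> is an
  additive endomorphism whose square is the identity. If \<open>c = \<one>\<close>, every element is
  its own negative. Otherwise only zero is fixed, since cancelling a nonzero fixed element on the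
  right would give \<open>c = \<one>\<close>.\<close>

lemma add_comm_group: "comm_group (add_monoid R)"
proof -
  interpret A: group "add_monoid R"
    by (rule add_group)
  define c where "c = inv\<^bsub>add_monoid R\<^esub> \<one>"
  have c: "c \<in> carrier R" "c \<oplus> \<one> = \<zero>" "\<one> \<oplus> c = \<zero>"
    unfolding c_def using A.inv_closed[of \<one>] A.l_inv[of \<one>] A.r_inv[of \<one>] by simp_all
  have "c \<otimes> c \<oplus> c = c \<otimes> (c \<oplus> \<one>)"
    using c(1) left_distrib[of c c \<one>] by simp
  then have "c \<otimes> c \<oplus> c = \<zero>"
    using c mult_zero by simp
  \<comment> \<open>Both \<open>c \<otimes> c\<close> and \<open>\<one>\<close> are additive
    inverses of \<open>c\<close>.\<close>
  then have cc: "c \<otimes> c = \<one>"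
    using c A.inv_equality[of "c \<otimes> c" c] A.inv_equality[of \<one> c] m_closed by simp
  show ?thesis
  proof (cases "c = \<one>")
    case True
    have "x \<oplus> x = \<zero>" if "x \<in> carrier R" for x
      using left_distrib[of x \<one> \<one>] that c True mult_zero by simp
    then show ?thesis
      by (intro A.comm_group_if_exponent_two) simp
  next
    case False
    show ?thesis
    proof (rule A.comm_group_if_fixed_point_free_involution[of "\<lambda>x. c \<otimes> x"])
      show "finite (carrier (add_monoid R))"
        using finite_carrier by simp
      show "(\<otimes>) c \<in> hom (add_monoid R) (add_monoid R)"
        by (rule homI) (use c m_closed left_distrib in auto)
      show "c \<otimes> (c \<otimes> x) = x" if "x \<in> carrier (add_monoid R)" for x
        using that c cc m_assoc[of c c x] by simp
      show "x = \<one>\<^bsub>add_monoid R\<^esub>" if "x \<in> carrier (add_monoid R)" "c \<otimes> x = x" for x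
        using that c False mult_right_cancel[of c \<one> x] by auto
    qed
  qed
qed

sublocale abelian_group R
  using comm_group_abelian_groupI[OF add_comm_group] .

lemma mult_minus: "\<lbrakk>a \<in> carrier R; b \<in> carrier R\<rbrakk> \<Longrightarrow> a \<otimes> (\<ominus> b) = \<ominus> (a \<otimes> b)"
  using left_distrib[of a "\<ominus> b" b] mult_zero m_closed
  by (intro minus_equality[symmetric]) (simp_all add: l_neg)

lemma card_gt_one: "card (carrier R) > 1"
  using card_mono[OF finite_carrier, of "{\<zero>, \<one>}"] one_neq_zero[symmetric] by simp

section \<open>Vectors and subgroups\<close>

abbreviation vecs :: "nat \<Rightarrow> (nat \<Rightarrow> 'a) set"
  where "vecs n \<equiv> {1..n} \<rightarrow>\<^sub>E carrier R"

lemma carrier_nf_vec [simp]: "carrier (nf_vec R n) = vecs n"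
  and one_nf_vec: "\<one>\<^bsub>nf_vec R n\<^esub> = (\<lambda>j\<in>{1..n}. \<zero>)"
  and mult_nf_vec: "x \<otimes>\<^bsub>nf_vec R n\<^esub> y = (\<lambda>j\<in>{1..n}. x j \<oplus> y j)"
  by (simp_all add: nf_vec_def)

lemma vecsD: "\<lbrakk>v \<in> vecs n; j \<in> {1..n}\<rbrakk> \<Longrightarrow> v j \<in> carrier R"
  by (rule PiE_mem)

lemma finite_vecs: "finite (vecs n)"
  using finite_carrier by (intro finite_PiE) auto

lemma comm_group_nf_vec: "comm_group (nf_vec R n)"
proof (rule group.group_comm_groupI)
  show "group (nf_vec R n)"
    unfolding nf_vec_def by (rule product_group) (rule add_group)
qed (auto simp: mult_nf_vec PiE_iff intro!: restrict_ext a_comm)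

lemma nf_scale_apply: "j \<in> {1..n} \<Longrightarrow> nf_scale R n v r j = v j \<otimes> r"
  by (simp add: nf_scale_def)

lemma nf_scale_closed: "\<lbrakk>v \<in> vecs n; r \<in> carrier R\<rbrakk> \<Longrightarrow> nf_scale R n v r \<in> vecs n"
  by (auto simp: nf_scale_def PiE_iff intro: m_closed)

text \<open>Closure under negation comes from closure under scalars: by left distributivity, scaling
  on the right by \<open>\<ominus> \<one>\<close> negates every entry.\<close>

lemma nf_subgroupI:
  assumes "H \<subseteq> vecs n" "\<one>\<^bsub>nf_vec R n\<^esub> \<in> H"
    and "\<And>x y. \<lbrakk>x \<in> H; y \<in> H\<rbrakk> \<Longrightarrow> x \<otimes>\<^bsub>nf_vec R n\<^esub> y \<in> H"
    and "\<And>x r. \<lbrakk>x \<in> H; r \<in> carrier R\<rbrakk> \<Longrightarrow> nf_scale R n x r \<in> H"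
  shows "nf_subgroup R n H"
  unfolding nf_subgroup_def
proof (intro conjI)
  interpret V: comm_group "nf_vec R n"
    by (rule comm_group_nf_vec)
  show "subgroup H (nf_vec R n)"
  proof (rule V.subgroupI)
    fix a assume a: "a \<in> H"
    then have aV: "a \<in> vecs n"
      using assms(1) by blast
    have s: "nf_scale R n a (\<ominus> \<one>) \<in> H"
      using a assms(4) by simp
    have "inv\<^bsub>nf_vec R n\<^esub> a = nf_scale R n a (\<ominus> \<one>)"
    proof (rule V.inv_equality)
      show "nf_scale R n a (\<ominus> \<one>) \<otimes>\<^bsub>nf_vec R n\<^esub> a = \<one>\<^bsub>nf_vec R n\<^esub>"
        unfolding one_nf_vec mult_nf_vec
        using aV by (intro restrict_ext) (auto simp: nf_scale_apply mult_minus PiE_iff l_neg)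
    qed (use aV nf_scale_closed in auto)
    then show "inv\<^bsub>nf_vec R n\<^esub> a \<in> H"
      using s by simp
  qed (use assms in auto)
qed (use assms(4) in blast)

lemma nf_subgroupD:
  assumes "nf_subgroup R n H"
  shows "H \<subseteq> vecs n" "subgroup H (nf_vec R n)" "\<one>\<^bsub>nf_vec R n\<^esub> \<in> H"
    "\<And>x y. \<lbrakk>x \<in> H; y \<in> H\<rbrakk> \<Longrightarrow> x \<otimes>\<^bsub>nf_vec R n\<^esub> y \<in> H"
    "\<And>x r. \<lbrakk>x \<in> H; r \<in> carrier R\<rbrakk> \<Longrightarrow> nf_scale R n x r \<in> H"
proof -
  show H: "subgroup H (nf_vec R n)"
    using assms by (simp add: nf_subgroup_def)
  show "H \<subseteq> vecs n"
    using subgroup.subset[OF H] by simp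
  show "\<one>\<^bsub>nf_vec R n\<^esub> \<in> H"
    by (rule subgroup.one_closed[OF H])
  show "\<And>x y. \<lbrakk>x \<in> H; y \<in> H\<rbrakk> \<Longrightarrow> x \<otimes>\<^bsub>nf_vec R n\<^esub> y \<in> H"
    by (rule subgroup.m_closed[OF H])
  show "\<And>x r. \<lbrakk>x \<in> H; r \<in> carrier R\<rbrakk> \<Longrightarrow> nf_scale R n x r \<in> H"
    using assms by (simp add: nf_subgroup_def)
qed

lemma nf_subgroup_vecs: "nf_subgroup R n (vecs n)"
  by (rule nf_subgroupI)
    (simp_all add: one_nf_vec mult_nf_vec nf_scale_def vecsD m_closed del: One_nat_def)

text \<open>Left multiplication by \<open>s\<close> is additive and, by associativity, commutes with
  right scaling. Linear relations of this shape are therefore inherited by generated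
  \<open>R\<close>-subgroups.\<close>

lemma nf_subgroup_coord_eq:
  assumes i: "i \<in> {1..n}" and j: "j \<in> {1..n}" and s: "s \<in> carrier R"
  shows "nf_subgroup R n {h \<in> vecs n. h j = s \<otimes> h i}" (is "nf_subgroup R n ?H")
proof (rule nf_subgroupI)
  show "\<one>\<^bsub>nf_vec R n\<^esub> \<in> ?H"
    using i j s by (simp add: one_nf_vec mult_zero)
next
  fix x y assume xy: "x \<in> ?H" "y \<in> ?H"
  then have "x \<otimes>\<^bsub>nf_vec R n\<^esub> y \<in> vecs n"
    using nf_subgroupD(4)[OF nf_subgroup_vecs] by blast
  moreover have "x j \<oplus> y j = s \<otimes> (x i \<oplus> y i)"
    using xy s vecsD[OF _ i] left_distrib by simp
  ultimately show "x \<otimes>\<^bsub>nf_vec R n\<^esub> y \<in> ?H"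
    using i j by (simp add: mult_nf_vec)
next
  fix x r assume xr: "x \<in> ?H" "r \<in> carrier R"
  have "x j \<otimes> r = s \<otimes> (x i \<otimes> r)"
    using xr s vecsD[OF _ i] m_assoc by simp
  then show "nf_scale R n x r \<in> ?H"
    using xr nf_scale_closed i j by (simp add: nf_scale_apply)
qed auto

lemma nf_subgroup_coord:
  "\<lbrakk>nf_subgroup R n H; x \<in> H; j \<in> {1..n}\<rbrakk> \<Longrightarrow> x j \<in> carrier R"
  by (meson nf_subgroupD(1) subsetD vecsD)

lemma nf_gen_subset: "nf_subgroup R n H \<Longrightarrow> V \<subseteq> H \<Longrightarrow> nf_gen R n V \<subseteq> H"
  unfolding nf_gen_def by blast

lemma nf_gen_superset: "V \<subseteq> nf_gen R n V"
  unfolding nf_gen_def by blast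

lemma nf_subgroup_nf_gen:
  assumes "V \<subseteq> vecs n"
  shows "nf_subgroup R n (nf_gen R n V)"
proof (rule nf_subgroupI)
  show "nf_gen R n V \<subseteq> vecs n"
    using nf_gen_subset nf_subgroup_vecs assms by blast
qed (auto simp: nf_gen_def nf_subgroupD)

section \<open>Entries of finite sums, and cyclic subgroups\<close>

lemma finprod_nf_vec_apply:
  assumes "finite I" "x \<in> I \<rightarrow> vecs n" "j \<in> {1..n}"
  shows "finprod (nf_vec R n) x I \<in> vecs n" "finprod (nf_vec R n) x I j = (\<Oplus>k\<in>I. x k j)"
proof -
  interpret V: comm_group "nf_vec R n"
    by (rule comm_group_nf_vec)
  show "finprod (nf_vec R n) x I \<in> vecs n"
    using V.finprod_closed[of x I] assms by simp
  show "finprod (nf_vec R n) x I j = (\<Oplus>k\<in>I. x k j)"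
    using assms
  proof (induction I rule: finite_induct)
    case empty
    then show ?case
      by (simp add: one_nf_vec)
  next
    case (insert a I)
    then have "finprod (nf_vec R n) x (insert a I) = x a \<otimes>\<^bsub>nf_vec R n\<^esub> finprod (nf_vec R n) x I"
      by (intro V.finprod_insert) auto
    moreover have "(\<Oplus>k\<in>insert a I. x k j) = x a j \<oplus> (\<Oplus>k\<in>I. x k j)"
      using insert vecsD by (intro finsum_insert) (auto simp: Pi_iff)
    ultimately show ?case
      using insert by (simp add: mult_nf_vec)
  qed
qed

lemma finprod_nf_vec_eq_zero:
  assumes "finite I" "x \<in> I \<rightarrow> vecs n" "j \<in> {1..n}" "\<And>k. k \<in> I \<Longrightarrow> x k j = \<zero>"
  shows "finprod (nf_vec R n) x I j = \<zero>"
  using finprod_nf_vec_apply(2)[OF assms(1-3)] assms(4)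
  by (simp add: add.finprod_one_eqI)

lemma finprod_nf_vec_eq_single:
  assumes "finite I" "x \<in> I \<rightarrow> vecs n" "j \<in> {1..n}" "k \<in> I"
    and "\<And>m. m \<in> I \<Longrightarrow> m \<noteq> k \<Longrightarrow> x m j = \<zero>"
  shows "finprod (nf_vec R n) x I j = x k j"
proof -
  have xk: "x m j \<in> carrier R" if "m \<in> I" for m
    using assms(2,3) that by (auto simp: Pi_iff PiE_iff)
  have "(\<Oplus>m\<in>I. x m j) = (\<Oplus>m\<in>I. if k = m then x m j else \<zero>)"
    by (rule add.finprod_cong') (use assms xk in auto)
  then show ?thesis
    using finprod_nf_vec_apply(2)[OF assms(1-3)] assms xk
      add.finprod_singleton[of k I "\<lambda>m. x m j"]
    by (simp add: Pi_iff)
qed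

lemma nf_subgroup_finprod:
  assumes H: "nf_subgroup R n H" and "finite I" "x \<in> I \<rightarrow> H"
  shows "finprod (nf_vec R n) x I \<in> H"
  using assms(2,3)
proof (induction I rule: finite_induct)
  interpret V: comm_group "nf_vec R n"
    by (rule comm_group_nf_vec)
  case empty
  then show ?case
    using nf_subgroupD(3)[OF H] by simp
next
  interpret V: comm_group "nf_vec R n"
    by (rule comm_group_nf_vec)
  case (insert a I)
  then show ?case
    using nf_subgroupD[OF H] by (subst V.finprod_insert) (auto simp: Pi_iff subset_iff)
qed

text \<open>Left distributivity makes right multiples of a fixed vector add by adding their
  scalars.\<close>

lemma nf_subgroup_cyclic:
  assumes u: "u \<in> vecs n"
  shows "nf_subgroup R n (nf_cyclic R n u)"
proof (rule nf_subgroupI)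
  have uj: "\<And>j. j \<in> {1..n} \<Longrightarrow> u j \<in> carrier R"
    using u by (auto simp: PiE_iff)
  show "nf_cyclic R n u \<subseteq> vecs n"
    using nf_scale_closed u by (auto simp: nf_cyclic_def)
  have "\<one>\<^bsub>nf_vec R n\<^esub> = nf_scale R n u \<zero>"
    unfolding one_nf_vec nf_scale_def using uj mult_zero by (auto intro: restrict_ext)
  then show "\<one>\<^bsub>nf_vec R n\<^esub> \<in> nf_cyclic R n u"
    by (auto simp: nf_cyclic_def)
  have add: "nf_scale R n u r \<otimes>\<^bsub>nf_vec R n\<^esub> nf_scale R n u r' = nf_scale R n u (r \<oplus> r')"
    if "r \<in> carrier R" "r' \<in> carrier R" for r r'
    using that uj left_distrib by (auto simp: mult_nf_vec nf_scale_def intro!: restrict_ext)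
  then show "x \<otimes>\<^bsub>nf_vec R n\<^esub> y \<in> nf_cyclic R n u"
    if "x \<in> nf_cyclic R n u" "y \<in> nf_cyclic R n u" for x y
    using that by (auto simp: nf_cyclic_def)
  have "nf_scale R n (nf_scale R n u r) r' = nf_scale R n u (r \<otimes> r')"
    if "r \<in> carrier R" "r' \<in> carrier R" for r r'
    using that uj m_assoc by (auto simp: nf_scale_def intro!: restrict_ext)
  then show "nf_scale R n x r \<in> nf_cyclic R n u"
    if "x \<in> nf_cyclic R n u" "r \<in> carrier R" for x r
    using that m_closed by (auto simp: nf_cyclic_def)
qed

end

context finite_nearfield
begin

section \<open>Coordinate classes\<close>

definition active :: "nat \<Rightarrow> (nat \<Rightarrow> 'a) set \<Rightarrow> nat set" where
  "active n T = {i\<in>{1..n}. \<exists>h\<in>T. h i \<noteq> \<zero>}"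

text \<open>Excluding the multiplier zero makes the relation symmetric. \<open>T\<close> may be any
  set of vectors, so that the classes of a generating set can be compared with those of the
  \<open>R\<close>-subgroup it generates.\<close>

definition coord_class :: "nat \<Rightarrow> (nat \<Rightarrow> 'a) set \<Rightarrow> nat \<Rightarrow> nat set" where
  "coord_class n T i = {j\<in>{1..n}. \<exists>s\<in>carrier R - {\<zero>}. \<forall>h\<in>T. h j = s \<otimes> h i}"

lemma activeI: "\<lbrakk>i \<in> {1..n}; h \<in> T; h i \<noteq> \<zero>\<rbrakk> \<Longrightarrow> i \<in> active n T"
  by (auto simp: active_def)

lemma active_range: "i \<in> active n T \<Longrightarrow> i \<in> {1..n}"
  by (simp add: active_def)

lemma inactive_zero: "\<lbrakk>i \<in> {1..n}; i \<notin> active n T; h \<in> T\<rbrakk> \<Longrightarrow> h i = \<zero>"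
  by (auto simp: active_def)

lemma coord_class_range: "j \<in> coord_class n T i \<Longrightarrow> j \<in> {1..n}"
  by (simp add: coord_class_def)

lemma coord_class_refl: "\<lbrakk>T \<subseteq> vecs n; i \<in> {1..n}\<rbrakk> \<Longrightarrow> i \<in> coord_class n T i"
proof -
  assume T: "T \<subseteq> vecs n" and i: "i \<in> {1..n}"
  have "\<forall>h\<in>T. h i = \<one> \<otimes> h i"
    using l_unit vecsD T i by (metis subsetD)
  moreover have "\<one> \<in> carrier R - {\<zero>}"
    by simp
  ultimately show ?thesis
    unfolding coord_class_def using i by blast
qed

lemma coord_class_trans:
  assumes T: "T \<subseteq> vecs n" and i: "i \<in> {1..n}"
    and j: "j \<in> coord_class n T i" and k: "k \<in> coord_class n T j"
  shows "k \<in> coord_class n T i"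
proof -
  obtain s where s: "s \<in> carrier R" "s \<noteq> \<zero>" "\<forall>h\<in>T. h j = s \<otimes> h i"
    using j by (auto simp: coord_class_def)
  obtain t where t: "t \<in> carrier R" "t \<noteq> \<zero>" "\<forall>h\<in>T. h k = t \<otimes> h j"
    using k by (auto simp: coord_class_def)
  have "h k = t \<otimes> s \<otimes> h i" if h: "h \<in> T" for h
  proof -
    have "h i \<in> carrier R"
      using T h i vecsD by blast
    then show ?thesis
      using bspec[OF s(3) h] bspec[OF t(3) h] m_assoc[OF t(1) s(1)] by simp
  qed
  moreover have "t \<otimes> s \<in> carrier R - {\<zero>}"
    using s t m_closed mult_nonzero by auto
  ultimately show ?thesis
    using coord_class_range[OF k] by (auto simp: coord_class_def)
qed

lemma coord_class_sym:
  assumes T: "T \<subseteq> vecs n" and i: "i \<in> {1..n}" and j: "j \<in> coord_class n T i"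
  shows "i \<in> coord_class n T j"
proof -
  obtain s where s: "s \<in> carrier R" "s \<noteq> \<zero>" "\<forall>h\<in>T. h j = s \<otimes> h i"
    using j by (auto simp: coord_class_def)
  obtain t where t: "t \<in> carrier R" "t \<noteq> \<zero>" "t \<otimes> s = \<one>"
    using s obtain_inverse by blast
  have "h i = t \<otimes> h j" if h: "h \<in> T" for h
  proof -
    have "h i \<in> carrier R"
      using T h i vecsD by blast
    then show ?thesis
      using bspec[OF s(3) h] t m_assoc[OF t(1) s(1), of "h i"] by simp
  qed
  then show ?thesis
    using i t by (auto simp: coord_class_def)
qed

lemma coord_class_eq:
  assumes T: "T \<subseteq> vecs n" and i: "i \<in> {1..n}" and j: "j \<in> coord_class n T i"
  shows "coord_class n T j = coord_class n T i"
  using coord_class_trans[OF T i j]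
    coord_class_trans[OF T coord_class_range[OF j] coord_class_sym[OF T i j]]
  by (intro equalityI subsetI)

text \<open>Scaling on the right by the inverse of \<open>h i\<close> normalises that entry and
  keeps all zeros.\<close>

lemma ex_normalized:
  assumes H: "nf_subgroup R n H" and h: "h \<in> H" and i: "i \<in> {1..n}" and nz: "h i \<noteq> \<zero>"
  shows "\<exists>z\<in>H. z i = \<one> \<and> (\<forall>j\<in>{1..n}. h j = \<zero> \<longrightarrow> z j = \<zero>)"
proof -
  obtain t where t: "t \<in> carrier R" "h i \<otimes> t = \<one>"
    using obtain_inverse nf_subgroup_coord[OF H h i] nz by blast
  show ?thesis
    by (rule bexI[of _ "nf_scale R n h t"])
      (use t h i nf_subgroupD(5)[OF H] zero_mult in \<open>simp_all add: nf_scale_apply\<close>)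
qed

lemma active_normalized:
  assumes H: "nf_subgroup R n H" and i: "i \<in> active n H"
  shows "\<exists>h\<in>H. h i = \<one>"
  using ex_normalized[OF H _ active_range[OF i]] i unfolding active_def by blast

text \<open>If no element separates \<open>i\<close> from \<open>j\<close>, vanishing at
  \<open>j\<close> forces vanishing at \<open>i\<close>, since normalising a counterexample would
  give a separating element. For any \<open>g\<close> in \<open>H\<close> with
  \<open>g i = \<one>\<close>, the entry \<open>g j\<close> then serves as the multiplier.\<close>

lemma coord_class_or_separated:
  assumes H: "nf_subgroup R n H" and i: "i \<in> active n H" and j: "j \<in> {1..n}"
  shows "j \<in> coord_class n H i \<or> (\<exists>h\<in>H. h i = \<one> \<and> h j = \<zero>)"
proof (rule disjCI)
  assume not_sep: "\<not> (\<exists>h\<in>H. h i = \<one> \<and> h j = \<zero>)"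
  have i': "i \<in> {1..n}"
    using active_range[OF i] .
  have zero: "h i = \<zero>" if "h \<in> H" "h j = \<zero>" for h
    using not_sep ex_normalized[OF H that(1) i'] that(2) j by blast
  obtain g where g: "g \<in> H" "g i = \<one>"
    using active_normalized[OF H i] by blast
  have gj: "g j \<in> carrier R" "g j \<noteq> \<zero>"
    using g not_sep nf_subgroup_coord[OF H g(1) j] by auto
  then obtain t where t: "t \<in> carrier R" "g j \<otimes> t = \<one>" "t \<otimes> g j = \<one>"
    using obtain_inverse by metis
  have "h j = g j \<otimes> h i" if h: "h \<in> H" for h
  proof -
    have hc: "h i \<in> carrier R" "h j \<in> carrier R"
      using nf_subgroup_coord[OF H h] i' j by auto
    let ?r = "t \<otimes> h j"
    \<comment> \<open>This subtracts from \<open>h\<close> the right multiple of \<open>g\<close>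
      that agrees with it at \<open>j\<close>; the difference vanishes at \<open>j\<close>, hence
      also at \<open>i\<close>.\<close>
    let ?h = "h \<otimes>\<^bsub>nf_vec R n\<^esub> nf_scale R n g (\<ominus> ?r)"
    have r: "?r \<in> carrier R" "g j \<otimes> ?r = h j"
      using t hc gj m_closed m_assoc[of "g j" t "h j"] by auto
    have "?h \<in> H"
      using nf_subgroupD(4,5)[OF H] h g r by simp
    moreover have "?h j = \<zero>"
      using j gj r hc mult_minus by (simp add: mult_nf_vec nf_scale_apply r_neg)
    ultimately have "?h i = \<zero>"
      by (rule zero)
    then have "h i \<oplus> \<ominus> ?r = \<zero>"
      using i' g r by (simp add: mult_nf_vec nf_scale_apply)
    then have "h i = ?r"
      using hc r by (metis add.inv_closed minus_equality minus_minus)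
    then show ?thesis
      using r by simp
  qed
  then show "j \<in> coord_class n H i"
    using gj j by (auto simp: coord_class_def)
qed

end

section \<open>Collecting zeros by means of the distributivity defect\<close>

context finite_proper_nearfield
begin

text \<open>The defect \<open>d\<close> vanishes as soon as one argument is zero. Applied entrywise
  to right multiples of \<open>x\<close> and \<open>y\<close> it therefore has the zeros of both,
  while at \<open>i\<close> it equals \<open>d a b\<close>, which is nonzero because
  \<open>a\<close>, \<open>b\<close>, \<open>c\<close> violate right distributivity.\<close>

lemma merge_zeros:
  assumes H: "nf_subgroup R n H" and x: "x \<in> H" and y: "y \<in> H" and i: "i \<in> {1..n}"
    and xi: "x i = \<one>" and yi: "y i = \<one>"
  shows "\<exists>z\<in>H. z i = \<one> \<and> (\<forall>j\<in>{1..n}. x j = \<zero> \<or> y j = \<zero> \<longrightarrow> z j = \<zero>)"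
proof -
  obtain a b c where abc: "a \<in> carrier R" "b \<in> carrier R" "c \<in> carrier R"
    and neq: "(a \<oplus> b) \<otimes> c \<noteq> a \<otimes> c \<oplus> b \<otimes> c"
    using not_right_distrib by blast
  \<comment> \<open>The subtraction is written as right multiplication by
    \<open>\<ominus> \<one>\<close>, so that \<open>d\<close> is assembled from addition and right
    scaling alone and its entrywise value on elements of \<open>H\<close> stays in
    \<open>H\<close>.\<close>
  define d where "d p q = (p \<oplus> q) \<otimes> c \<oplus> (p \<otimes> c \<oplus> q \<otimes> c) \<otimes> (\<ominus> \<one>)" for p q
  have d_eq: "d p q = (p \<oplus> q) \<otimes> c \<oplus> \<ominus> (p \<otimes> c \<oplus> q \<otimes> c)"
    if "p \<in> carrier R" "q \<in> carrier R" for p q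
    using that abc m_closed mult_minus by (simp add: d_def)
  have d_zero: "d p q = \<zero>" if "p \<in> carrier R" "q \<in> carrier R" "p = \<zero> \<or> q = \<zero>" for p q
    using that abc m_closed zero_mult by (auto simp: d_eq r_neg)
  have "d a b \<noteq> \<zero>"
  proof
    assume "d a b = \<zero>"
    then have "(a \<oplus> b) \<otimes> c = \<ominus> (\<ominus> (a \<otimes> c \<oplus> b \<otimes> c))"
      using abc m_closed d_eq[of a b]
      by (intro minus_equality[symmetric]) auto
    then show False
      using abc m_closed neq minus_minus[of "a \<otimes> c \<oplus> b \<otimes> c"] by auto
  qed
  \<comment> \<open>Since \<open>x\<close> and \<open>y\<close> are \<open>\<one>\<close> at
    \<open>i\<close>, scaling them by \<open>a\<close> and \<open>b\<close> places the violating
    pair at that coordinate.\<close>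
  let ?x = "nf_scale R n x a" and ?y = "nf_scale R n y b"
  let ?z = "nf_scale R n (?x \<otimes>\<^bsub>nf_vec R n\<^esub> ?y) c \<otimes>\<^bsub>nf_vec R n\<^esub>
      nf_scale R n (nf_scale R n ?x c \<otimes>\<^bsub>nf_vec R n\<^esub> nf_scale R n ?y c) (\<ominus> \<one>)"
  have zH: "?z \<in> H"
    using x y abc nf_subgroupD(4,5)[OF H] by simp
  have z: "?z j = d (x j \<otimes> a) (y j \<otimes> b)" if "j \<in> {1..n}" for j
    using that by (simp add: mult_nf_vec nf_scale_apply d_def)
  have "?z i \<noteq> \<zero>"
    using z[OF i] xi yi abc \<open>d a b \<noteq> \<zero>\<close> by simp
  then obtain w where w: "w \<in> H" "w i = \<one>" "\<forall>j\<in>{1..n}. ?z j = \<zero> \<longrightarrow> w j = \<zero>"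
    using ex_normalized[OF H zH i] by blast
  have "?z j = \<zero>" if j: "j \<in> {1..n}" "x j = \<zero> \<or> y j = \<zero>" for j
  proof -
    have "x j \<otimes> a \<in> carrier R" "y j \<otimes> b \<in> carrier R"
      using nf_subgroup_coord[OF H _ j(1)] x y abc m_closed by auto
    moreover have "x j \<otimes> a = \<zero> \<or> y j \<otimes> b = \<zero>"
      using j(2) zero_mult abc by metis
    ultimately show ?thesis
      using z[OF j(1)] d_zero by simp
  qed
  then show ?thesis
    using w by blast
qed

text \<open>Induction on \<open>A\<close>: each step merges the zeros found so far with one more
  separating element.\<close>

lemma simultaneous_separation:
  assumes H: "nf_subgroup R n H" and i: "i \<in> active n H"
    and "finite A" "A \<subseteq> {1..n}" "\<And>j. j \<in> A \<Longrightarrow> \<exists>h\<in>H. h i = \<one> \<and> h j = \<zero>"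
  shows "\<exists>h\<in>H. h i = \<one> \<and> (\<forall>j\<in>A. h j = \<zero>)"
  using assms(3-5)
proof (induction A rule: finite_induct)
  case empty
  then show ?case
    using active_normalized[OF H i] by simp
next
  case (insert a A)
  obtain x where x: "x \<in> H" "x i = \<one>" "\<forall>j\<in>A. x j = \<zero>"
    using insert by auto
  obtain y where y: "y \<in> H" "y i = \<one>" "y a = \<zero>"
    using insert.prems by blast
  have "\<exists>z\<in>H. z i = \<one> \<and> (\<forall>j\<in>{1..n}. x j = \<zero> \<or> y j = \<zero> \<longrightarrow> z j = \<zero>)"
    by (rule merge_zeros[OF H x(1) y(1) active_range[OF i] x(2) y(2)])
  then show ?case
    using x(3) y(3) insert.prems(1) by blast
qed

text \<open>Each coordinate outside the class can be separated from \<open>i\<close>, hence all of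
  them at once. These elements become the summands of the decomposition.\<close>

lemma ex_class_vector:
  assumes H: "nf_subgroup R n H" and i: "i \<in> active n H"
  shows "\<exists>u\<in>H. u i = \<one> \<and> (\<forall>j\<in>{1..n}. j \<notin> coord_class n H i \<longrightarrow> u j = \<zero>)"
proof -
  have "\<exists>u\<in>H. u i = \<one> \<and> (\<forall>j\<in>{1..n} - coord_class n H i. u j = \<zero>)"
    using coord_class_or_separated[OF H i]
    by (intro simultaneous_separation[OF H i]) blast+
  then show ?thesis
    by blast
qed

end

context finite_nearfield
begin

section \<open>Direct sums and dimension\<close>

lemma vecs_eqI:
  assumes "x \<in> vecs n" "y \<in> vecs n" "\<And>j. j \<in> {1..n} \<Longrightarrow> x j = y j"
  shows "x = y"
  by (rule PiE_ext[OF assms])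

lemma cyclic_vecs: "\<lbrakk>u \<in> vecs n; x \<in> nf_cyclic R n u\<rbrakk> \<Longrightarrow> x \<in> vecs n"
  using nf_subgroupD(1)[OF nf_subgroup_cyclic] by blast

lemma cyclic_zero: "\<lbrakk>x \<in> nf_cyclic R n u; j \<in> {1..n}; u j = \<zero>\<rbrakk> \<Longrightarrow> x j = \<zero>"
  by (auto simp: nf_cyclic_def nf_scale_apply zero_mult)

lemma cyclic_self: "u \<in> vecs n \<Longrightarrow> u \<in> nf_cyclic R n u"
proof -
  assume u: "u \<in> vecs n"
  have "u = nf_scale R n u \<one>"
  proof (rule vecs_eqI[OF u nf_scale_closed[OF u one_carrier]])
    fix j assume "j \<in> {1..n}"
    then show "u j = nf_scale R n u \<one> j"
      using vecsD[OF u] by (simp add: nf_scale_apply)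
  qed
  then show ?thesis
    unfolding nf_cyclic_def by (rule image_eqI[OF _ one_carrier])
qed

lemma disjoint_supp_zero:
  assumes "disjoint_family_on (\<lambda>k. nf_supp R n (u k)) I"
    and "k \<in> I" "m \<in> I" "m \<noteq> k" "j \<in> nf_supp R n (u k)"
  shows "u m j = \<zero>"
  using assms by (auto simp: disjoint_family_on_def nf_supp_def)

text \<open>A right multiple of \<open>u m\<close> vanishes wherever \<open>u m\<close> does, so on
  the support of \<open>u k\<close> only the summand with index \<open>k\<close>
  contributes.\<close>

lemma finprod_cyclic_apply:
  assumes fin: "finite I" and u: "\<And>k. k \<in> I \<Longrightarrow> u k \<in> vecs n"
    and disj: "disjoint_family_on (\<lambda>k. nf_supp R n (u k)) I"
    and x: "\<And>k. k \<in> I \<Longrightarrow> x k \<in> nf_cyclic R n (u k)"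
    and k: "k \<in> I" and j: "j \<in> nf_supp R n (u k)"
  shows "finprod (nf_vec R n) x I j = x k j"
proof (rule finprod_nf_vec_eq_single[OF fin _ _ k])
  show "x \<in> I \<rightarrow> vecs n"
    using u x cyclic_vecs by blast
  show j': "j \<in> {1..n}"
    using j by (simp add: nf_supp_def)
  show "x m j = \<zero>" if "m \<in> I" "m \<noteq> k" for m
    using cyclic_zero[OF x[OF that(1)] j'] disjoint_supp_zero[OF disj k that j] by blast
qed

text \<open>Reduces the direct sum to conditions on entries. Uniqueness holds because the sum
  determines each summand on its own support and the summand is zero elsewhere; existence assembles
  the coefficients from \<open>coeff\<close>.\<close>

lemma internal_direct_sum_cyclicI:
  assumes T: "nf_subgroup R n T" and fin: "finite I" and u: "\<And>k. k \<in> I \<Longrightarrow> u k \<in> T"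
    and disj: "disjoint_family_on (\<lambda>k. nf_supp R n (u k)) I"
    and coeff: "\<And>h k. \<lbrakk>h \<in> T; k \<in> I\<rbrakk> \<Longrightarrow>
      \<exists>r\<in>carrier R. \<forall>j\<in>nf_supp R n (u k). h j = u k j \<otimes> r"
    and zero: "\<And>h j. \<lbrakk>h \<in> T; j \<in> {1..n}; \<forall>k\<in>I. j \<notin> nf_supp R n (u k)\<rbrakk> \<Longrightarrow> h j = \<zero>"
  shows "internal_direct_sum (nf_vec R n) I (\<lambda>k. nf_cyclic R n (u k)) T"
  unfolding internal_direct_sum_def
proof (intro conjI ballI)
  have uV: "u k \<in> vecs n" if "k \<in> I" for k
    using nf_subgroupD(1)[OF T] u[OF that] by blast
  show "subgroup (nf_cyclic R n (u k)) (nf_vec R n)" if "k \<in> I" for k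
    by (rule nf_subgroupD(2)[OF nf_subgroup_cyclic[OF uV[OF that]]])
  let ?X = "\<Pi>\<^sub>E k\<in>I. nf_cyclic R n (u k)"
  let ?S = "\<lambda>x. finprod (nf_vec R n) x I"
  have apply_supp: "?S x j = x k j" if "x \<in> ?X" "k \<in> I" "j \<in> nf_supp R n (u k)" for x k j
    by (rule finprod_cyclic_apply[OF fin uV disj _ that(2,3)]) (use that(1) in auto)
  show "bij_betw ?S ?X T"
  proof (rule bij_betw_imageI[OF inj_onI equalityI[OF image_subsetI subsetI]])
    fix x y assume x: "x \<in> ?X" and y: "y \<in> ?X" and eq: "?S x = ?S y"
    show "x = y"
    proof (rule PiE_ext[OF x y])
      fix k assume k: "k \<in> I"
      have xk: "x k \<in> nf_cyclic R n (u k)" and yk: "y k \<in> nf_cyclic R n (u k)"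
        using x y k by auto
      show "x k = y k"
      proof (rule vecs_eqI)
        show "x k \<in> vecs n" "y k \<in> vecs n"
          using cyclic_vecs[OF uV[OF k]] xk yk by auto
        fix j assume j: "j \<in> {1..n}"
        show "x k j = y k j"
        proof (cases "u k j = \<zero>")
          case True
          then show ?thesis
            using cyclic_zero[OF xk j] cyclic_zero[OF yk j] by simp
        next
          case False
          then have "j \<in> nf_supp R n (u k)"
            using j by (simp add: nf_supp_def)
          then show ?thesis
            using apply_supp[OF x k] apply_supp[OF y k] eq by metis
        qed
      qed
    qed
  next
    fix x assume x: "x \<in> ?X"
    have "x k \<in> T" if "k \<in> I" for k
      using PiE_mem[OF x that] nf_subgroupD(5)[OF T u[OF that]] by (auto simp: nf_cyclic_def)
    then show "?S x \<in> T"
      by (intro nf_subgroup_finprod[OF T fin]) blast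
  next
    fix h assume h: "h \<in> T"
    have "\<exists>r. \<forall>k\<in>I. r k \<in> carrier R \<and> (\<forall>j\<in>nf_supp R n (u k). h j = u k j \<otimes> r k)"
      using coeff[OF h] by (intro bchoice) blast
    then obtain r where r: "\<And>k. k \<in> I \<Longrightarrow> r k \<in> carrier R"
        "\<And>k. k \<in> I \<Longrightarrow> \<forall>j\<in>nf_supp R n (u k). h j = u k j \<otimes> r k"
      by blast
    define x where "x = (\<lambda>k\<in>I. nf_scale R n (u k) (r k))"
    have xc: "x k \<in> nf_cyclic R n (u k)" if "k \<in> I" for k
      using that r(1) by (simp add: x_def nf_cyclic_def)
    then have x: "x \<in> ?X"
      by (auto simp: x_def)
    have xV: "x \<in> I \<rightarrow> vecs n"
      using xc cyclic_vecs[OF uV] by blast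
    have "h = ?S x"
    proof (rule vecs_eqI)
      show "h \<in> vecs n"
        using h nf_subgroupD(1)[OF T] by blast
      show "?S x \<in> vecs n"
        by (rule nf_subgroupD(1)[OF nf_subgroup_vecs, THEN subsetD],
            rule nf_subgroup_finprod[OF nf_subgroup_vecs fin xV])
      fix j assume j: "j \<in> {1..n}"
      show "h j = ?S x j"
      proof (cases "\<exists>k\<in>I. j \<in> nf_supp R n (u k)")
        case True
        then obtain k where k: "k \<in> I" "j \<in> nf_supp R n (u k)"
          by blast
        have "?S x j = u k j \<otimes> r k"
          using apply_supp[OF x k] k j by (simp add: x_def nf_scale_apply)
        then show ?thesis
          using r(2)[OF k(1)] k(2) by simp
      next
        case False
        then have "x k j = \<zero>" if "k \<in> I" for k
          using cyclic_zero[OF xc[OF that] j] that j by (auto simp: nf_supp_def)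
        then have "?S x j = \<zero>"
          by (rule finprod_nf_vec_eq_zero[OF fin xV j])
        then show ?thesis
          using zero[OF h j] False by simp
      qed
    qed
    then show "h \<in> ?S ` ?X"
      by (rule image_eqI[OF _ x])
  qed
qed

text \<open>The converse passage, which reads the conditions on entries off a given direct
  sum.\<close>

lemma internal_direct_sum_cyclicD:
  assumes T: "internal_direct_sum (nf_vec R n) I (\<lambda>k. nf_cyclic R n (u k)) T"
    and fin: "finite I" and u: "\<And>k. k \<in> I \<Longrightarrow> u k \<in> vecs n"
    and disj: "disjoint_family_on (\<lambda>k. nf_supp R n (u k)) I"
  shows "\<And>k. k \<in> I \<Longrightarrow> u k \<in> T"
    and "\<And>h k. \<lbrakk>h \<in> T; k \<in> I\<rbrakk> \<Longrightarrow> \<exists>r\<in>carrier R. \<forall>j\<in>nf_supp R n (u k). h j = u k j \<otimes> r"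
    and "\<And>h j. \<lbrakk>h \<in> T; j \<in> {1..n}; \<forall>k\<in>I. j \<notin> nf_supp R n (u k)\<rbrakk> \<Longrightarrow> h j = \<zero>"
proof -
  let ?X = "\<Pi>\<^sub>E k\<in>I. nf_cyclic R n (u k)"
  let ?S = "\<lambda>x. finprod (nf_vec R n) x I"
  have img: "?S ` ?X = T"
    using T by (simp add: internal_direct_sum_def bij_betw_def)
  have XV: "x \<in> I \<rightarrow> vecs n" if "x \<in> ?X" for x
    using that cyclic_vecs[OF u] by (blast dest: PiE_mem)
  have apply_supp: "?S x j = x k j" if "x \<in> ?X" "k \<in> I" "j \<in> nf_supp R n (u k)" for x k j
    by (rule finprod_cyclic_apply[OF fin u disj _ that(2,3)]) (use that(1) in auto)
  have apply_off: "?S x j = \<zero>"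
    if "x \<in> ?X" "j \<in> {1..n}" "\<forall>k\<in>I. j \<notin> nf_supp R n (u k)" for x j
  proof (rule finprod_nf_vec_eq_zero[OF fin XV[OF that(1)] that(2)])
    fix k assume k: "k \<in> I"
    show "x k j = \<zero>"
      by (rule cyclic_zero[OF PiE_mem[OF that(1) k] that(2)]) (use that k in \<open>auto simp: nf_supp_def\<close>)
  qed
  show "u k \<in> T" if k: "k \<in> I" for k
  proof -
    \<comment> \<open>The family with the single nonzero component \<open>u k\<close> has sum
      \<open>u k\<close>.\<close>
    define x where "x = (\<lambda>m\<in>I. if m = k then u k else \<one>\<^bsub>nf_vec R n\<^esub>)"
    have x: "x \<in> ?X"
      using cyclic_self[OF u] nf_subgroupD(3)[OF nf_subgroup_cyclic[OF u]]
      by (auto simp: x_def)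
    have "?S x j = u k j" if j: "j \<in> {1..n}" for j
    proof -
      have "?S x j = x k j"
        by (rule finprod_nf_vec_eq_single[OF fin XV[OF x] j k])
          (use j in \<open>simp add: x_def one_nf_vec del: One_nat_def\<close>)
      then show ?thesis
        using k by (simp add: x_def)
    qed
    then have "?S x = u k"
      by (intro vecs_eqI[OF _ u[OF k]] finprod_nf_vec_apply(1)[OF fin XV[OF x]]
          nf_subgroup_finprod[OF nf_subgroup_vecs fin XV[OF x]])
    moreover have "?S x \<in> T"
      unfolding img[symmetric] by (rule imageI[OF x])
    ultimately show ?thesis
      by simp
  qed
  show "\<exists>r\<in>carrier R. \<forall>j\<in>nf_supp R n (u k). h j = u k j \<otimes> r" if h: "h \<in> T" and k: "k \<in> I" for h k
  proof -
    obtain x where x: "x \<in> ?X" "h = ?S x"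
      using img h by blast
    obtain r where r: "r \<in> carrier R" "x k = nf_scale R n (u k) r"
      using PiE_mem[OF x(1) k] by (auto simp: nf_cyclic_def)
    have "h j = u k j \<otimes> r" if j: "j \<in> nf_supp R n (u k)" for j
    proof -
      have "j \<in> {1..n}"
        using j by (simp add: nf_supp_def)
      then show ?thesis
        using apply_supp[OF x(1) k j] x(2) r by (simp add: nf_scale_apply del: One_nat_def)
    qed
    then show ?thesis
      using r by blast
  qed
  show "h j = \<zero>" if "h \<in> T" "j \<in> {1..n}" "\<forall>k\<in>I. j \<notin> nf_supp R n (u k)" for h j
    using apply_off[OF _ that(2,3)] that(1) img by blast
qed

text \<open>Determined by \<open>T\<close> without choosing a decomposition; comparing every
  decomposition with it yields uniqueness of the dimension.\<close>

definition num_classes :: "nat \<Rightarrow> (nat \<Rightarrow> 'a) set \<Rightarrow> nat" where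
  "num_classes n T = card (coord_class n T ` active n T)"

lemma finite_active: "finite (active n T)"
  by (simp add: active_def)

text \<open>Evaluating the relation between \<open>i\<close> and \<open>j\<close> at
  \<open>u\<close>, where \<open>u i = \<one>\<close>, identifies its multiplier as
  \<open>u j\<close>.\<close>

lemma class_vector_coord:
  assumes H: "nf_subgroup R n H" and i: "i \<in> {1..n}" and u: "u \<in> H" "u i = \<one>"
    and j: "j \<in> coord_class n H i"
  shows "u j \<noteq> \<zero>" and "h \<in> H \<Longrightarrow> h j = u j \<otimes> h i"
proof -
  obtain s where s: "s \<in> carrier R" "s \<noteq> \<zero>" "\<forall>h\<in>H. h j = s \<otimes> h i"
    using j by (auto simp: coord_class_def)
  have "u j = s"
    using bspec[OF s(3) u(1)] u(2) s(1) by simp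
  then show "u j \<noteq> \<zero>" "h \<in> H \<Longrightarrow> h j = u j \<otimes> h i"
    using s by blast+
qed

lemma ex_nonzero_coord:
  assumes u: "u \<in> vecs n" and nz: "u \<noteq> \<one>\<^bsub>nf_vec R n\<^esub>"
  shows "\<exists>i\<in>{1..n}. u i \<noteq> \<zero>"
proof (rule ccontr)
  assume zero: "\<not> ?thesis"
  have "u = \<one>\<^bsub>nf_vec R n\<^esub>"
  proof (rule vecs_eqI[OF u nf_subgroupD(3)[OF nf_subgroup_vecs]])
    fix j assume "j \<in> {1..n}"
    then show "u j = \<one>\<^bsub>nf_vec R n\<^esub> j"
      using zero unfolding one_nf_vec by auto
  qed
  then show False
    using nz by simp
qed

text \<open>The supports of the summands are exactly the classes of active coordinates. They are
  nonempty and disjoint, so distinct indices give distinct classes and \<open>l\<close> counts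
  them.\<close>

lemma num_classes_unique:
  assumes T: "nf_subgroup R n T" and dec: "has_disjoint_decomposition R n T l"
  shows "l = num_classes n T"
proof -
  obtain u :: "nat \<Rightarrow> nat \<Rightarrow> 'a" where
    u: "\<And>k. k \<in> {1..l} \<Longrightarrow> u k \<in> vecs n" and
    nz: "\<And>k. k \<in> {1..l} \<Longrightarrow> u k \<noteq> \<one>\<^bsub>nf_vec R n\<^esub>" and
    disj: "disjoint_family_on (\<lambda>k. nf_supp R n (u k)) {1..l}" and
    ds: "internal_direct_sum (nf_vec R n) {1..l} (\<lambda>k. nf_cyclic R n (u k)) T"
    using dec unfolding has_disjoint_decomposition_def carrier_nf_vec by blast
  have D1: "u k \<in> T" if "k \<in> {1..l}" for k
    by (rule internal_direct_sum_cyclicD(1)[OF ds finite_atLeastAtMost u disj that])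
  have D2: "\<exists>r\<in>carrier R. \<forall>j\<in>nf_supp R n (u k). h j = u k j \<otimes> r"
    if "h \<in> T" "k \<in> {1..l}" for h k
    by (rule internal_direct_sum_cyclicD(2)[OF ds finite_atLeastAtMost u disj that])
  have D3: "h j = \<zero>" if "h \<in> T" "j \<in> {1..n}" "\<forall>k\<in>{1..l}. j \<notin> nf_supp R n (u k)" for h j
    by (rule internal_direct_sum_cyclicD(3)[OF ds finite_atLeastAtMost u disj that])
  let ?supp = "\<lambda>k. nf_supp R n (u k)"
  have supp_ne: "?supp k \<noteq> {}" if k: "k \<in> {1..l}" for k
    using ex_nonzero_coord[OF u[OF k] nz[OF k]] unfolding nf_supp_def by blast
  have inj: "inj_on ?supp {1..l}"
  proof (rule inj_onI)
    fix k m assume "k \<in> {1..l}" "m \<in> {1..l}" "?supp k = ?supp m"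
    then show "k = m"
      using disj supp_ne[of k] unfolding disjoint_family_on_def by blast
  qed
  have act: "active n T = (\<Union>k\<in>{1..l}. ?supp k)"
  proof (intro equalityI subsetI)
    fix j assume "j \<in> active n T"
    then obtain h where h: "h \<in> T" "h j \<noteq> \<zero>" and j: "j \<in> {1..n}"
      unfolding active_def by blast
    show "j \<in> (\<Union>k\<in>{1..l}. ?supp k)"
      using D3[OF h(1) j] h(2) by blast
  next
    fix j assume "j \<in> (\<Union>k\<in>{1..l}. ?supp k)"
    then obtain k where k: "k \<in> {1..l}" "j \<in> {1..n}" "u k j \<noteq> \<zero>"
      unfolding nf_supp_def by blast
    show "j \<in> active n T"
      by (rule activeI[OF k(2) D1[OF k(1)] k(3)])
  qed
  have cls: "coord_class n T i = ?supp k" if k: "k \<in> {1..l}" and i: "i \<in> ?supp k" for i k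
  proof (intro equalityI subsetI)
    have i': "i \<in> {1..n}" "u k i \<noteq> \<zero>"
      using i by (auto simp: nf_supp_def)
    fix j
    {
      assume j: "j \<in> coord_class n T i"
      then obtain s where s: "s \<in> carrier R" "s \<noteq> \<zero>" "\<forall>h\<in>T. h j = s \<otimes> h i"
        by (auto simp: coord_class_def)
      \<comment> \<open>The element \<open>u k\<close> of \<open>T\<close> itself shows that the
        class of \<open>i\<close> does not leave its support.\<close>
      have "u k j = s \<otimes> u k i"
        using s D1[OF k] by blast
      then have "u k j \<noteq> \<zero>"
        using mult_nonzero[OF s(1) _ s(2) i'(2)] vecsD[OF u[OF k] i'(1)] by simp
      then show "j \<in> ?supp k"
        using coord_class_range[OF j] by (simp add: nf_supp_def)
    next
      assume j: "j \<in> ?supp k"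
      then have j': "j \<in> {1..n}" "u k j \<noteq> \<zero>"
        by (auto simp: nf_supp_def)
      have c: "u k i \<in> carrier R" "u k j \<in> carrier R"
        using vecsD[OF u[OF k]] i' j' by auto
      obtain t where t: "t \<in> carrier R" "t \<noteq> \<zero>" "t \<otimes> u k i = \<one>"
        using obtain_inverse[OF c(1) i'(2)] by blast
      \<comment> \<open>On one support \<open>h\<close> is a right multiple of \<open>u k\<close>;
        eliminating the common scalar \<open>r\<close> between the entries at \<open>i\<close> and
        \<open>j\<close> leaves a left multiplier independent of \<open>h\<close>.\<close>
      have "h j = u k j \<otimes> t \<otimes> h i" if h: "h \<in> T" for h
      proof -
        obtain r where r: "r \<in> carrier R" "h i = u k i \<otimes> r" "h j = u k j \<otimes> r"
          using D2[OF h k] i j by blast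
        have "u k j \<otimes> t \<otimes> (u k i \<otimes> r) = u k j \<otimes> (t \<otimes> u k i \<otimes> r)"
          using m_assoc[OF c(2) t(1) m_closed[OF c(1) r(1)]] m_assoc[OF t(1) c(1) r(1)] by simp
        then show ?thesis
          using r t(3) by simp
      qed
      moreover have "u k j \<otimes> t \<in> carrier R - {\<zero>}"
        using m_closed[OF c(2) t(1)] mult_nonzero[OF c(2) t(1) j'(2) t(2)] by blast
      ultimately show "j \<in> coord_class n T i"
        using j' unfolding coord_class_def by blast
    }
  qed
  have "coord_class n T ` active n T = ?supp ` {1..l}"
  proof (intro equalityI subsetI)
    fix c assume "c \<in> coord_class n T ` active n T"
    then show "c \<in> ?supp ` {1..l}"
      using act cls by auto
  next
    fix c assume "c \<in> ?supp ` {1..l}"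
    then obtain k where k: "k \<in> {1..l}" "c = ?supp k"
      by blast
    obtain i where "i \<in> ?supp k"
      using supp_ne[OF k(1)] by blast
    then show "c \<in> coord_class n T ` active n T"
      using cls[OF k(1)] k act by blast
  qed
  then show ?thesis
    using card_image[OF inj] by (simp add: num_classes_def)
qed

end

section \<open>Existence of the decomposition\<close>

context finite_proper_nearfield
begin

text \<open>One class vector is taken for each class. Its support is the whole class, distinct
  classes are disjoint, and the normalised entry makes \<open>h (rep k)\<close> the coefficient of
  \<open>h\<close> at the summand \<open>k\<close>.\<close>

lemma num_classes_decomposition:
  assumes T: "nf_subgroup R n T"
  shows "has_disjoint_decomposition R n T (num_classes n T)"
proof -
  let ?C = "coord_class n T ` active n T"
  let ?l = "num_classes n T"
  have TV: "T \<subseteq> vecs n"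
    by (rule nf_subgroupD(1)[OF T])
  obtain e where e: "bij_betw e {1..?l} ?C"
    unfolding num_classes_def
    using ex_bij_betw_nat_finite_1[OF finite_imageI[OF finite_active]] by blast
  have eC: "e k \<in> ?C" if "k \<in> {1..?l}" for k
    using bij_betwE[OF e] that by blast
  then have "\<exists>rep. \<forall>k\<in>{1..?l}. rep k \<in> active n T \<and> e k = coord_class n T (rep k)"
    by (intro bchoice) blast
  then obtain rep where rep: "\<And>k. k \<in> {1..?l} \<Longrightarrow> rep k \<in> active n T"
      "\<And>k. k \<in> {1..?l} \<Longrightarrow> e k = coord_class n T (rep k)"
    by blast
  have "\<exists>u. \<forall>k\<in>{1..?l}. u k \<in> T \<and> u k (rep k) = \<one> \<and>
      (\<forall>j\<in>{1..n}. j \<notin> coord_class n T (rep k) \<longrightarrow> u k j = \<zero>)"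
    using ex_class_vector[OF T rep(1)] by (intro bchoice) blast
  then obtain u where u: "\<And>k. k \<in> {1..?l} \<Longrightarrow> u k \<in> T" "\<And>k. k \<in> {1..?l} \<Longrightarrow> u k (rep k) = \<one>"
      "\<And>k j. \<lbrakk>k \<in> {1..?l}; j \<in> {1..n}; j \<notin> coord_class n T (rep k)\<rbrakk> \<Longrightarrow> u k j = \<zero>"
    by blast
  have repn: "rep k \<in> {1..n}" if "k \<in> {1..?l}" for k
    using active_range[OF rep(1)[OF that]] .
  note coord = class_vector_coord[OF T repn u(1,2)]
  have supp: "nf_supp R n (u k) = e k" if k: "k \<in> {1..?l}" for k
    using coord(1)[OF k k k] u(3)[OF k] coord_class_range rep(2)[OF k]
    unfolding nf_supp_def by blast
  have disj: "disjoint_family_on (\<lambda>k. nf_supp R n (u k)) {1..?l}"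
    unfolding disjoint_family_on_def
  proof (intro ballI impI)
    fix k m assume km: "k \<in> {1..?l}" "m \<in> {1..?l}" "k \<noteq> m"
    then have "e k \<noteq> e m"
      using bij_betw_imp_inj_on[OF e] by (auto dest: inj_onD)
    moreover have "e k = e m" if "i \<in> e k" "i \<in> e m" for i
      using coord_class_eq[OF TV repn] that rep(2) km by metis
    ultimately show "nf_supp R n (u k) \<inter> nf_supp R n (u m) = {}"
      using supp km by blast
  qed
  have "internal_direct_sum (nf_vec R n) {1..?l} (\<lambda>k. nf_cyclic R n (u k)) T"
  proof (rule internal_direct_sum_cyclicI[OF T finite_atLeastAtMost u(1) disj])
    fix h k assume h: "h \<in> T" and k: "k \<in> {1..?l}"
    show "\<exists>r\<in>carrier R. \<forall>j\<in>nf_supp R n (u k). h j = u k j \<otimes> r"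
      using coord(2)[OF k k k _ h] nf_subgroup_coord[OF T h repn[OF k]] supp[OF k] rep(2)[OF k]
      by blast
  next
    fix h j assume h: "h \<in> T" and j: "j \<in> {1..n}" "\<forall>k\<in>{1..?l}. j \<notin> nf_supp R n (u k)"
    have "j \<notin> active n T"
    proof
      assume "j \<in> active n T"
      then have "coord_class n T j \<in> e ` {1..?l}"
        using bij_betw_imp_surj_on[OF e] by simp
      then obtain k where k: "k \<in> {1..?l}" "e k = coord_class n T j"
        by force
      then have "j \<in> nf_supp R n (u k)"
        using coord_class_refl[OF TV j(1)] supp by blast
      then show False
        using j k by blast
    qed
    then show "h j = \<zero>"
      using inactive_zero j h by blast
  qed
  moreover have "u k \<noteq> \<one>\<^bsub>nf_vec R n\<^esub>" if "k \<in> {1..?l}" for k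
    using u(2)[OF that] repn[OF that] one_neq_zero by (auto simp: one_nf_vec simp del: one_neq_zero)
  moreover have "u k \<in> vecs n" if "k \<in> {1..?l}" for k
    using u(1)[OF that] TV by blast
  ultimately show ?thesis
    unfolding has_disjoint_decomposition_def carrier_nf_vec using disj by blast
qed

lemma nf_dim_eq_num_classes:
  assumes T: "nf_subgroup R n T"
  shows "nf_dim R n T = num_classes n T"
  unfolding nf_dim_def
  using num_classes_decomposition[OF T] num_classes_unique[OF T] by (rule the_equality)

end

context finite_nearfield
begin

section \<open>Seed sets\<close>

text \<open>The relation cuts out an \<open>R\<close>-subgroup containing \<open>V\<close>, hence
  containing everything \<open>V\<close> generates.\<close>

lemma nf_gen_coord_eq:
  assumes V: "V \<subseteq> vecs n" and ij: "i \<in> {1..n}" "j \<in> {1..n}" and s: "s \<in> carrier R"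
    and eq: "\<And>v. v \<in> V \<Longrightarrow> v j = s \<otimes> v i" and h: "h \<in> nf_gen R n V"
  shows "h j = s \<otimes> h i"
proof -
  have "V \<subseteq> {h \<in> vecs n. h j = s \<otimes> h i}"
    using V eq by auto
  then show ?thesis
    using nf_gen_subset[OF nf_subgroup_coord_eq[OF ij s]] h by blast
qed

lemma nf_gen_active:
  assumes V: "V \<subseteq> vecs n" and i: "i \<in> active n (nf_gen R n V)"
  shows "i \<in> active n V"
proof (rule ccontr)
  assume "i \<notin> active n V"
  then have z: "v i = \<zero>" if "v \<in> V" for v
    using inactive_zero[OF active_range[OF i] _ that] by blast
  have "h i = \<zero>" if h: "h \<in> nf_gen R n V" for h
  proof -
    \<comment> \<open>Vanishing at \<open>i\<close> is the relation with multiplier zero between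
      \<open>i\<close> and itself.\<close>
    have "h i = \<zero> \<otimes> h i"
      by (rule nf_gen_coord_eq[OF V active_range[OF i] active_range[OF i] zero_closed _ h])
        (use z zero_mult[OF zero_closed] in simp)
    then show ?thesis
      using zero_mult nf_subgroup_coord[OF nf_subgroup_nf_gen[OF V] h active_range[OF i]] by simp
  qed
  then show False
    using i unfolding active_def by blast
qed

lemma nf_gen_coord_class:
  assumes V: "V \<subseteq> vecs n" and i: "i \<in> {1..n}" and j: "j \<in> coord_class n V i"
  shows "j \<in> coord_class n (nf_gen R n V) i"
proof -
  obtain s where s: "s \<in> carrier R - {\<zero>}" "\<forall>v\<in>V. v j = s \<otimes> v i"
    using j unfolding coord_class_def by blast
  have "h j = s \<otimes> h i" if "h \<in> nf_gen R n V" for h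
    by (rule nf_gen_coord_eq[OF V i coord_class_range[OF j] _ _ that]) (use s in auto)
  then show ?thesis
    using s(1) coord_class_range[OF j] unfolding coord_class_def by blast
qed

text \<open>Each coordinate class yields a column in $R^V$, and distinct classes have columns on
  distinct punctured lines.\<close>

lemma num_classes_nf_gen_less:
  assumes fin: "finite V" and V: "V \<subseteq> vecs n"
  shows "num_classes n (nf_gen R n V) * (card (carrier R) - 1) < card (carrier R) ^ card V"
proof -
  let ?T = "nf_gen R n V"
  let ?C = "coord_class n ?T ` active n ?T"
  let ?U = "carrier R - {\<zero>}"
  have TV: "?T \<subseteq> vecs n"
    by (rule nf_subgroupD(1)[OF nf_subgroup_nf_gen[OF V]])
  have "\<exists>rep. \<forall>c\<in>?C. rep c \<in> active n ?T \<and> c = coord_class n ?T (rep c)"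
    by (intro bchoice) blast
  then obtain rep where rep: "\<And>c. c \<in> ?C \<Longrightarrow> rep c \<in> active n ?T"
      "\<And>c. c \<in> ?C \<Longrightarrow> c = coord_class n ?T (rep c)"
    by blast
  have repn: "rep c \<in> {1..n}" if "c \<in> ?C" for c
    using active_range[OF rep(1)[OF that]] .
  have vc: "v (rep c) \<in> carrier R" if "v \<in> V" "c \<in> ?C" for v c
    using vecsD[OF _ repn[OF that(2)]] that V by blast
  have nz: "\<exists>v\<in>V. v (rep c) \<noteq> \<zero>" if c: "c \<in> ?C" for c
    using nf_gen_active[OF V rep(1)[OF c]] unfolding active_def by blast
  \<comment> \<open>\<open>F\<close> sends a class and a nonzero scalar to the corresponding left
    multiple of the column of the class, that is, to a point of its punctured line.\<close>
  define F where "F = (\<lambda>(c, s). \<lambda>v\<in>V. s \<otimes> v (rep c))"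
  have inj: "inj_on F (?C \<times> ?U)"
  proof (rule inj_onI)
    fix x y assume x: "x \<in> ?C \<times> ?U" and y: "y \<in> ?C \<times> ?U" and Fxy: "F x = F y"
    obtain c s where cs: "x = (c, s)" and c: "c \<in> ?C" and s: "s \<in> carrier R" "s \<noteq> \<zero>"
      using x by blast
    obtain d t where dt: "y = (d, t)" and d: "d \<in> ?C" and t: "t \<in> carrier R" "t \<noteq> \<zero>"
      using y by blast
    have eq: "F (c, s) = F (d, t)"
      using Fxy cs dt by simp
    have eqv: "s \<otimes> v (rep c) = t \<otimes> v (rep d)" if "v \<in> V" for v
      using fun_cong[OF eq, of v] that by (simp add: F_def)
    obtain s' where s': "s' \<in> carrier R" "s' \<noteq> \<zero>" "s' \<otimes> s = \<one>"
      using obtain_inverse[OF s] by blast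
    have col: "v (rep c) = s' \<otimes> t \<otimes> v (rep d)" if v: "v \<in> V" for v
      using m_assoc[OF s'(1) s(1) vc[OF v c]] m_assoc[OF s'(1) t(1) vc[OF v d]]
        eqv[OF v] s'(3) vc[OF v c] by simp
    have "s' \<otimes> t \<in> carrier R - {\<zero>}"
      using m_closed[OF s'(1) t(1)] mult_nonzero[OF s'(1) t(1) s'(2) t(2)] by blast
    \<comment> \<open>Proportional columns make the two coordinates equivalent on \<open>V\<close>,
      and equivalence passes to the generated \<open>R\<close>-subgroup.\<close>
    then have "rep c \<in> coord_class n V (rep d)"
      using repn[OF c] col unfolding coord_class_def by blast
    then have "coord_class n ?T (rep c) = coord_class n ?T (rep d)"
      using coord_class_eq[OF TV repn[OF d]] nf_gen_coord_class[OF V repn[OF d]] by blast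
    then have cd: "c = d"
      using rep(2)[OF c] rep(2)[OF d] by simp
    obtain v where v: "v \<in> V" "v (rep c) \<noteq> \<zero>"
      using nz[OF c] by blast
    then have "s = t"
      using mult_right_cancel[OF s(1) t(1) vc[OF v(1) c] v(2)] eqv[OF v(1)] cd by simp
    then show "x = y"
      using cd cs dt by simp
  qed
  \<comment> \<open>The zero column is never attained, which makes the final inequality
    strict.\<close>
  have "F ` (?C \<times> ?U) \<subset> (\<Pi>\<^sub>E v\<in>V. carrier R)"
  proof (rule psubsetI)
    show "F ` (?C \<times> ?U) \<subseteq> (\<Pi>\<^sub>E v\<in>V. carrier R)"
      unfolding F_def using vc m_closed by (auto intro!: restrict_PiE_iff[THEN iffD2])
    have "(\<lambda>v\<in>V. \<zero>) \<noteq> F (c, s)" if c: "c \<in> ?C" and s: "s \<in> ?U" for c s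
    proof
      assume eq: "(\<lambda>v\<in>V. \<zero>) = F (c, s)"
      obtain v where v: "v \<in> V" "v (rep c) \<noteq> \<zero>"
        using nz[OF c] by blast
      have "s \<otimes> v (rep c) = \<zero>"
        using fun_cong[OF eq, of v] v(1) by (simp add: F_def)
      then show False
        using mult_nonzero[OF _ vc[OF v(1) c] _ v(2)] s by simp
    qed
    then have "(\<lambda>v\<in>V. \<zero>) \<notin> F ` (?C \<times> ?U)"
      by (auto simp: image_iff)
    moreover have "(\<lambda>v\<in>V. \<zero>) \<in> (\<Pi>\<^sub>E v\<in>V. carrier R)"
      by simp
    ultimately show "F ` (?C \<times> ?U) \<noteq> (\<Pi>\<^sub>E v\<in>V. carrier R)"
      by blast
  qed
  then have "card (F ` (?C \<times> ?U)) < card (\<Pi>\<^sub>E v\<in>V. carrier R)"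
    using fin finite_carrier by (intro psubset_card_mono finite_PiE) auto
  moreover have "card (F ` (?C \<times> ?U)) = num_classes n ?T * (card (carrier R) - 1)"
    using card_image[OF inj] finite_carrier
    by (simp add: card_cartesian_product num_classes_def)
  ultimately show ?thesis
    using fin by (simp add: card_PiE)
qed

text \<open>Greedy choice: each column already chosen forbids at most as many new columns as there
  are nonzero scalars, and the zero column is forbidden too. The cardinality bound leaves room for
  one more.\<close>

lemma ex_nonproportional_family:
  assumes "finite C" "card C * (card (carrier R) - 1) < card (carrier R) ^ k"
  shows "\<exists>p :: 'c \<Rightarrow> nat \<Rightarrow> 'a.
    (\<forall>c\<in>C. p c \<in> {..<k} \<rightarrow>\<^sub>E carrier R \<and> (\<exists>t<k. p c t \<noteq> \<zero>)) \<and>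
    (\<forall>c\<in>C. \<forall>d\<in>C. \<forall>s\<in>carrier R - {\<zero>}. (\<forall>t<k. p c t = s \<otimes> p d t) \<longrightarrow> c = d)"
  using assms
proof (induction C rule: finite_induct)
  case empty
  then show ?case
    by simp
next
  case (insert a C)
  let ?U = "carrier R - {\<zero>}"
  let ?P = "{..<k} \<rightarrow>\<^sub>E carrier R"
  have le: "card C * card ?U + card ?U < card (carrier R) ^ k"
    using insert finite_carrier by simp
  then have "card C * (card (carrier R) - 1) < card (carrier R) ^ k"
    using finite_carrier by simp
  from insert.IH[OF this] obtain p :: "'c \<Rightarrow> nat \<Rightarrow> 'a" where
    p: "\<And>c. c \<in> C \<Longrightarrow> p c \<in> ?P" "\<And>c. c \<in> C \<Longrightarrow> \<exists>t<k. p c t \<noteq> \<zero>" and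
    np: "\<And>c d s. \<lbrakk>c \<in> C; d \<in> C; s \<in> ?U; \<forall>t<k. p c t = s \<otimes> p d t\<rbrakk> \<Longrightarrow> c = d"
    by blast
  let ?I = "(\<lambda>(c, s). \<lambda>t\<in>{..<k}. s \<otimes> p c t) ` (C \<times> ?U)"
  let ?B = "insert (\<lambda>t\<in>{..<k}. \<zero>) ?I"
  have fin: "finite (C \<times> ?U)"
    using insert.hyps(1) finite_carrier by simp
  have "card ?B \<le> Suc (card ?I)"
    by (rule card_insert_le_m1) simp_all
  also have "\<dots> \<le> Suc (card C * card ?U)"
    using card_image_le[OF fin] unfolding card_cartesian_product by blast
  also have "\<dots> \<le> card C * card ?U + card ?U"
    using card_gt_one finite_carrier by simp
  also have "\<dots> < card ?P"
    using le by (simp add: card_PiE)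
  finally have "\<not> ?P \<subseteq> ?B"
    using card_mono[of ?B ?P] insert.hyps(1) finite_carrier by (auto simp: not_le)
  then obtain w where w: "w \<in> ?P" "w \<notin> ?B"
    by blast
  have w0: "\<exists>t<k. w t \<noteq> \<zero>"
  proof (rule ccontr)
    assume "\<not> ?thesis"
    then have "w = (\<lambda>t\<in>{..<k}. \<zero>)"
      by (intro PiE_ext[OF w(1)]) auto
    then show False
      using w(2) by blast
  qed
  have wp: False if "c \<in> C" "s \<in> ?U" "\<forall>t<k. w t = s \<otimes> p c t" for c s
  proof -
    have pc: "p c t \<in> carrier R" if "t < k" for t
      using PiE_mem[OF p(1)[OF \<open>c \<in> C\<close>]] that by simp
    have "w = (\<lambda>t\<in>{..<k}. s \<otimes> p c t)"
      using that pc m_closed by (intro PiE_ext[OF w(1)]) auto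
    then have "w \<in> ?B"
      using that(1,2) by (intro insertI2 image_eqI[of _ _ "(c, s)"]) simp_all
    then show False
      using w(2) by blast
  qed
  \<comment> \<open>\<open>w\<close> was chosen to avoid left multiples of old columns; inverting
    \<open>s\<close> also rules out an old column being a multiple of \<open>w\<close>.\<close>
  have pw: False if cs: "c \<in> C" "s \<in> ?U" and eq: "\<forall>t<k. p c t = s \<otimes> w t" for c s
  proof -
    obtain r where r: "r \<in> carrier R" "r \<noteq> \<zero>" "r \<otimes> s = \<one>"
      using obtain_inverse cs(2) by blast
    have "w t = r \<otimes> p c t" if t: "t < k" for t
    proof -
      have "w t \<in> carrier R"
        using PiE_mem[OF w(1)] t by simp
      then show ?thesis
        using m_assoc[of r s "w t"] r cs(2) eq t by simp
    qed
    then show False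
      using wp[OF cs(1), of r] r by blast
  qed
  show ?case
  proof (intro exI[of _ "p(a := w)"] conjI ballI impI)
    fix c assume "c \<in> insert a C"
    then show "(p(a := w)) c \<in> ?P" "\<exists>t<k. (p(a := w)) c t \<noteq> \<zero>"
      using p w w0 by auto
  next
    fix c d s assume "c \<in> insert a C" "d \<in> insert a C" "s \<in> ?U"
      "\<forall>t<k. (p(a := w)) c t = s \<otimes> (p(a := w)) d t"
    then show "c = d"
      using np[of c d s] wp[of d s] pw[of c s] by (auto split: if_splits)
  qed
qed

end

section \<open>Construction of small seed sets\<close>

context finite_proper_nearfield
begin

text \<open>Each summand \<open>u c\<close> receives a column \<open>p c\<close>, and the seeds
  \<open>v t\<close> combine the summands with the entries of these columns as right scalars. Since
  the columns are nonzero and nonproportional, the generated \<open>R\<close>-subgroup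
  \<open>?H\<close> does not identify coordinates from different supports, so its class vectors
  recover every \<open>u c\<close>.\<close>

lemma ex_seed_set:
  assumes T: "nf_subgroup R n T"
    and less: "num_classes n T * (card (carrier R) - 1) < card (carrier R) ^ k"
  shows "\<exists>V. seed_set R n T V \<and> card V \<le> k"
proof -
  let ?l = "num_classes n T"
  have TV: "T \<subseteq> vecs n"
    by (rule nf_subgroupD(1)[OF T])
  obtain u :: "nat \<Rightarrow> nat \<Rightarrow> 'a" where
    u: "\<And>c. c \<in> {1..?l} \<Longrightarrow> u c \<in> vecs n" and
    nz: "\<And>c. c \<in> {1..?l} \<Longrightarrow> u c \<noteq> \<one>\<^bsub>nf_vec R n\<^esub>" and
    disj: "disjoint_family_on (\<lambda>c. nf_supp R n (u c)) {1..?l}" and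
    ds: "internal_direct_sum (nf_vec R n) {1..?l} (\<lambda>c. nf_cyclic R n (u c)) T"
    using num_classes_decomposition[OF T]
    unfolding has_disjoint_decomposition_def carrier_nf_vec by blast
  have uT: "u c \<in> T" if "c \<in> {1..?l}" for c
    by (rule internal_direct_sum_cyclicD(1)[OF ds finite_atLeastAtMost u disj that])
  have coeff: "\<exists>r\<in>carrier R. \<forall>j\<in>nf_supp R n (u c). h j = u c j \<otimes> r"
    if "h \<in> T" "c \<in> {1..?l}" for h c
    by (rule internal_direct_sum_cyclicD(2)[OF ds finite_atLeastAtMost u disj that])
  have "card {1..?l} * (card (carrier R) - 1) < card (carrier R) ^ k"
    using less by simp
  from ex_nonproportional_family[OF finite_atLeastAtMost this]
  obtain p :: "nat \<Rightarrow> nat \<Rightarrow> 'a" where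
    p_all: "\<forall>c\<in>{1..?l}. p c \<in> {..<k} \<rightarrow>\<^sub>E carrier R \<and> (\<exists>t<k. p c t \<noteq> \<zero>)" and
    np_all: "\<forall>c\<in>{1..?l}. \<forall>d\<in>{1..?l}. \<forall>s\<in>carrier R - {\<zero>}.
      (\<forall>t<k. p c t = s \<otimes> p d t) \<longrightarrow> c = d"
    by (elim exE conjE)
  have p: "p c \<in> {..<k} \<rightarrow>\<^sub>E carrier R" "\<exists>t<k. p c t \<noteq> \<zero>" if "c \<in> {1..?l}" for c
    using bspec[OF p_all that] by simp_all
  have np: "c = d" if "c \<in> {1..?l}" "d \<in> {1..?l}" "s \<in> carrier R - {\<zero>}"
    "\<forall>t<k. p c t = s \<otimes> p d t" for c d s
    by (rule np_all[THEN bspec[OF _ that(1)], THEN bspec[OF _ that(2)], THEN bspec[OF _ that(3)],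
          THEN mp, OF that(4)])
  have pc: "p c t \<in> carrier R" if "c \<in> {1..?l}" "t < k" for c t
    using PiE_mem[OF p(1)[OF that(1)]] that(2) by simp
  define x where "x t c = nf_scale R n (u c) (p c t)" for t c
  define v where "v t = finprod (nf_vec R n) (x t) {1..?l}" for t
  have xc: "x t c \<in> nf_cyclic R n (u c)" if "t < k" "c \<in> {1..?l}" for t c
    using pc[OF that(2,1)] by (simp add: x_def nf_cyclic_def)
  have xV: "x t \<in> {1..?l} \<rightarrow> vecs n" if "t < k" for t
    using xc[OF that] cyclic_vecs[OF u] by blast
  have vT: "v t \<in> T" if "t < k" for t
    unfolding v_def
  proof (rule nf_subgroup_finprod[OF T finite_atLeastAtMost], rule Pi_I)
    fix c assume c: "c \<in> {1..?l}"
    show "x t c \<in> T"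
      unfolding x_def by (rule nf_subgroupD(5)[OF T uT[OF c] pc[OF c that]])
  qed
  have v_supp: "v t j = u c j \<otimes> p c t" if t: "t < k" and c: "c \<in> {1..?l}" and j: "j \<in> nf_supp R n (u c)"
    for t c j
  proof -
    have "j \<in> {1..n}"
      using j by (simp add: nf_supp_def)
    then have "x t c j = u c j \<otimes> p c t"
      unfolding x_def by (rule nf_scale_apply)
    moreover have "v t j = x t c j"
      unfolding v_def by (rule finprod_cyclic_apply[OF finite_atLeastAtMost u disj xc[OF t] c j])
    ultimately show ?thesis
      by simp
  qed
  have v_off: "v t j = \<zero>" if t: "t < k" and j: "j \<in> {1..n}" "\<forall>c\<in>{1..?l}. j \<notin> nf_supp R n (u c)"
    for t j
    by (rule internal_direct_sum_cyclicD(3)[OF ds finite_atLeastAtMost u disj vT[OF t] j])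
  let ?V = "v ` {..<k}"
  let ?H = "nf_gen R n ?V"
  have VV: "?V \<subseteq> vecs n"
    using vT TV by blast
  have H: "nf_subgroup R n ?H"
    by (rule nf_subgroup_nf_gen[OF VV])
  have HT: "?H \<subseteq> T"
    by (rule nf_gen_subset[OF T]) (use vT in blast)
  have vH: "v t \<in> ?H" if "t < k" for t
    by (rule subsetD[OF nf_gen_superset imageI]) (use that in simp)
  have uH: "u c \<in> ?H" if c: "c \<in> {1..?l}" for c
  proof -
    obtain i where i: "i \<in> {1..n}" "u c i \<noteq> \<zero>"
      using ex_nonzero_coord[OF u[OF c] nz[OF c]] by blast
    then have isupp: "i \<in> nf_supp R n (u c)"
      by (simp add: nf_supp_def)
    have ui: "u c i \<in> carrier R"
      by (rule vecsD[OF u[OF c] i(1)])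
    obtain t where t: "t < k" "p c t \<noteq> \<zero>"
      using p(2)[OF c] by blast
    have vti: "v t i \<noteq> \<zero>"
      using v_supp[OF t(1) c isupp] mult_nonzero[OF ui pc[OF c t(1)] i(2) t(2)] by simp
    have iH: "i \<in> active n ?H"
      by (rule activeI[OF i(1) vH[OF t(1)] vti])
    \<comment> \<open>A relation in \<open>?H\<close> between \<open>i\<close> and a coordinate
      \<open>j\<close> in the support of \<open>u d\<close> would make the columns
      \<open>p d\<close> and \<open>p c\<close> proportional, hence \<open>d = c\<close>.\<close>
    have cls: "j \<in> nf_supp R n (u c)" if j: "j \<in> coord_class n ?H i" for j
    proof -
      have jn: "j \<in> {1..n}"
        by (rule coord_class_range[OF j])
      obtain s where s: "s \<in> carrier R" "s \<noteq> \<zero>" "\<forall>h\<in>?H. h j = s \<otimes> h i"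
        using j unfolding coord_class_def by blast
      have "v t j = s \<otimes> v t i"
        using s(3) vH[OF t(1)] by blast
      then have "v t j \<noteq> \<zero>"
        using mult_nonzero[OF s(1) _ s(2) vti] nf_subgroup_coord[OF H vH[OF t(1)] i(1)] by simp
      then obtain d where d: "d \<in> {1..?l}" "j \<in> nf_supp R n (u d)"
        using v_off[OF t(1) jn] by blast
      have uj: "u d j \<in> carrier R" "u d j \<noteq> \<zero>"
        using vecsD[OF u[OF d(1)] jn] d(2) by (auto simp: nf_supp_def)
      obtain r where r: "r \<in> carrier R" "r \<noteq> \<zero>" "r \<otimes> u d j = \<one>"
        using obtain_inverse[OF uj] by blast
      have su: "s \<otimes> u c i \<in> carrier R" "s \<otimes> u c i \<noteq> \<zero>"
        using m_closed[OF s(1) ui] mult_nonzero[OF s(1) ui s(2) i(2)] by auto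
      have "p d t' = r \<otimes> (s \<otimes> u c i) \<otimes> p c t'" if t': "t' < k" for t'
      proof -
        note pd = pc[OF d(1) t'] and pc' = pc[OF c t']
        have "v t' j = s \<otimes> v t' i"
          using s(3) vH[OF t'] by blast
        \<comment> \<open>Evaluating the relation at the seed \<open>v t'\<close> gives an equation
          between column entries, which is then solved for \<open>p d t'\<close>.\<close>
        then have eq: "u d j \<otimes> p d t' = s \<otimes> (u c i \<otimes> p c t')"
          using v_supp[OF t' d] v_supp[OF t' c isupp] by simp
        have "p d t' = r \<otimes> (u d j \<otimes> p d t')"
          using m_assoc[OF r(1) uj(1) pd] r(3) pd by simp
        also have "\<dots> = r \<otimes> (s \<otimes> u c i \<otimes> p c t')"
          using eq m_assoc[OF s(1) ui pc'] by simp
        finally show ?thesis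
          using m_assoc[OF r(1) su(1) pc'] by simp
      qed
      moreover have "r \<otimes> (s \<otimes> u c i) \<in> carrier R - {\<zero>}"
        using m_closed[OF r(1) su(1)] mult_nonzero[OF r(1) su(1) r(2) su(2)] by blast
      ultimately have "d = c"
        using np[OF d(1) c] by blast
      then show ?thesis
        using d(2) by simp
    qed
    \<comment> \<open>The class vector \<open>w\<close> vanishes off the support of
      \<open>u c\<close> and, as an element of \<open>T\<close>, is a right multiple of
      \<open>u c\<close> on it. The scalar is nonzero because \<open>w i = \<one>\<close>, so
      \<open>u c\<close> can be recovered from \<open>w\<close>.\<close>
    obtain w where w: "w \<in> ?H" "w i = \<one>" "\<forall>j\<in>{1..n}. j \<notin> coord_class n ?H i \<longrightarrow> w j = \<zero>"
      using ex_class_vector[OF H iH] by blast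
    obtain r where r: "r \<in> carrier R" "\<forall>j\<in>nf_supp R n (u c). w j = u c j \<otimes> r"
      using coeff[OF _ c] w(1) HT by blast
    have "u c i \<otimes> r = \<one>"
      using r(2) isupp w(2) by metis
    then have "r \<noteq> \<zero>"
      using mult_zero[OF ui] one_neq_zero by metis
    then obtain r' where r': "r' \<in> carrier R" "r \<otimes> r' = \<one>"
      using obtain_inverse r(1) by blast
    have "u c = nf_scale R n w r'"
    proof (rule vecs_eqI[OF u[OF c] nf_scale_closed[OF _ r'(1)]])
      show "w \<in> vecs n"
        using w(1) nf_subgroupD(1)[OF H] by blast
      fix j assume j: "j \<in> {1..n}"
      have "u c j = w j \<otimes> r'"
      proof (cases "j \<in> nf_supp R n (u c)")
        case True
        then show ?thesis
          using r r' m_assoc[OF vecsD[OF u[OF c] j] r(1) r'(1)] vecsD[OF u[OF c] j] by simp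
      next
        case False
        then have "w j = \<zero>" "u c j = \<zero>"
          using w(3) j cls by (blast, simp add: nf_supp_def)
        then show ?thesis
          using zero_mult[OF r'(1)] by simp
      qed
      then show "u c j = nf_scale R n w r' j"
        using nf_scale_apply[OF j] by simp
    qed
    then show ?thesis
      using nf_subgroupD(5)[OF H w(1) r'(1)] by simp
  qed
  have "T \<subseteq> ?H"
  proof
    fix h assume "h \<in> T"
    then have "h \<in> (\<lambda>y. finprod (nf_vec R n) y {1..?l}) ` (\<Pi>\<^sub>E c\<in>{1..?l}. nf_cyclic R n (u c))"
      using ds by (simp add: internal_direct_sum_def bij_betw_def)
    then obtain y where y: "h = finprod (nf_vec R n) y {1..?l}"
        "y \<in> (\<Pi>\<^sub>E c\<in>{1..?l}. nf_cyclic R n (u c))"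
      by (rule imageE)
    have "y c \<in> ?H" if c: "c \<in> {1..?l}" for c
    proof -
      obtain r where r: "r \<in> carrier R" "y c = nf_scale R n (u c) r"
        using PiE_mem[OF y(2) c] by (auto simp: nf_cyclic_def)
      show ?thesis
        unfolding r(2) by (rule nf_subgroupD(5)[OF H uH[OF c] r(1)])
    qed
    then show "h \<in> ?H"
      unfolding y(1) by (intro nf_subgroup_finprod[OF H finite_atLeastAtMost] Pi_I)
  qed
  then have "seed_set R n T ?V"
    using HT VV by (simp add: seed_set_def)
  \<comment> \<open>Only an inequality, since different \<open>t\<close> may give the same vector
    \<open>v t\<close>.\<close>
  moreover have "card ?V \<le> k"
    using card_image_le[of "{..<k}" v] by simp
  ultimately show ?thesis
    by blast
qed

lemma nf_gen_subgroup: "nf_subgroup R n T \<Longrightarrow> nf_gen R n T = T"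
  by (intro equalityI nf_gen_subset nf_gen_superset order.refl)

text \<open>The size of any seed set satisfies \<open>?P\<close>, and any \<open>k\<close>
  satisfying \<open>?P\<close> admits a seed set with at most \<open>k\<close> elements, so the two
  least values agree. The finite set \<open>T\<close> seeds itself, so both exist.\<close>

lemma seed_number_eq:
  assumes T: "nf_subgroup R n T"
  shows "seed_number R n T
    = (LEAST k. nf_dim R n T * (card (carrier R) - 1) < card (carrier R) ^ k)"
    (is "_ = (LEAST k. ?P k)")
proof -
  let ?S = "\<lambda>k. \<exists>V. seed_set R n T V \<and> card V = k"
  have S_imp_P: "?P k" if "?S k" for k
    using that num_classes_nf_gen_less unfolding nf_dim_eq_num_classes[OF T] seed_set_def carrier_nf_vec
    by blast
  have TV: "T \<subseteq> vecs n"
    by (rule nf_subgroupD(1)[OF T])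
  have "seed_set R n T T"
    unfolding seed_set_def carrier_nf_vec
    using TV finite_subset[OF TV finite_vecs] nf_gen_subgroup[OF T] by blast
  then have ex: "?S (card T)"
    by blast
  have "?S (LEAST k. ?S k)"
    by (rule LeastI[of ?S, OF ex])
  then have "(LEAST k. ?P k) \<le> (LEAST k. ?S k)"
    by (intro Least_le S_imp_P)
  moreover have "?P (LEAST k. ?P k)"
    by (rule LeastI[of ?P, OF S_imp_P[OF ex]])
  then obtain V where V: "seed_set R n T V" "card V \<le> (LEAST k. ?P k)"
    using ex_seed_set[OF T] unfolding nf_dim_eq_num_classes[OF T] by blast
  then have "(LEAST k. ?S k) \<le> card V"
    by (intro Least_le) blast
  ultimately show ?thesis
    unfolding seed_number_def using V(2) by linarith
qed

end

section \<open>Arithmetic of the bound and its logarithmic form\<close>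

lemma repunit_ge_iff:
  assumes "q > 1"
  shows "(real q ^ k - 1) / (real q - 1) \<ge> real l \<longleftrightarrow> l * (q - 1) < q ^ k"
proof -
  have "(real q ^ k - 1) / (real q - 1) \<ge> real l \<longleftrightarrow> real l * (real q - 1) + 1 \<le> real q ^ k"
    using assms by (simp add: pos_le_divide_eq le_diff_eq)
  also have "\<dots> \<longleftrightarrow> real (l * (q - 1) + 1) \<le> real (q ^ k)"
    using assms by (simp add: of_nat_diff add.commute)
  \<comment> \<open>Over the naturals the added one turns into strictness.\<close>
  also have "\<dots> \<longleftrightarrow> l * (q - 1) < q ^ k"
    unfolding of_nat_le_iff by linarith
  finally show ?thesis .
qed

text \<open>The lower bound uses \<open>l \<le> l * (q - 1) < q ^ k\<close>. For the upper bound,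
  minimality at the predecessor \<open>j\<close> of \<open>k\<close> gives
  \<open>q ^ j \<le> l * q\<close>; one unit of the constant two comes from this factor
  \<open>q\<close>, the other from passing from \<open>j\<close> to \<open>k\<close>.\<close>

lemma log_bounds_of_least:
  fixes q l :: nat
  assumes q: "q > 1" and l: "l \<ge> 1" and k: "l * (q - 1) < q ^ k"
    and least: "\<And>j. j < k \<Longrightarrow> q ^ j \<le> l * (q - 1)"
  shows "log q l \<le> k" and "k \<le> 2 + log q l"
proof -
  have "1 \<le> q - 1"
    using q by linarith
  then have "l \<le> l * (q - 1)"
    using mult_le_mono2[of 1 "q - 1" l] by simp
  then have lk: "l < q ^ k"
    using k by (rule le_less_trans)
  then have "real l \<le> real q ^ k"
    by (metis less_imp_le of_nat_le_iff of_nat_power)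
  then show "log q l \<le> k"
    using q l by (simp add: log_le_iff powr_realpow)
  have "k \<noteq> 0"
    using lk l by (cases k) auto
  then obtain j where j: "k = Suc j"
    using not0_implies_Suc by blast
  have "q ^ j \<le> l * (q - 1)"
    using least j by simp
  also have "\<dots> \<le> l * q"
    by simp
  finally have "real (q ^ j) \<le> real (l * q)"
    unfolding of_nat_le_iff .
  then have "real q powr real j \<le> real l * real q"
    using q by (simp add: powr_realpow)
  then have "real j \<le> log q (real l * real q)"
    using q l by (simp add: le_log_iff)
  also have "\<dots> = log q l + 1"
    using q l by (simp add: log_mult)
  finally show "k \<le> 2 + log q l"
    using j by simp
qed

theorem corollary25:
  fixes R :: "('a, 'b) ring_scheme" and n l :: nat and T :: "(nat \<Rightarrow> 'a) set"
  assumes "proper_nearfield R"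
    and "finite (carrier R)"
    and "n \<ge> 1"
    and "nf_subgroup R n T"
    and "nf_dim R n T = l"
  shows "seed_number R n T =
      (LEAST k::nat.
        (real (card (carrier R)) ^ k - 1) / (real (card (carrier R)) - 1) \<ge> real l) \<and>
    (l \<ge> 1 \<longrightarrow>
      log (real (card (carrier R))) (real l) \<le> real (seed_number R n T) \<and>
      real (seed_number R n T) \<le> 2 + log (real (card (carrier R))) (real l))"
proof -
  interpret proper_nearfield R
    by (rule assms(1))
  interpret finite_proper_nearfield R
    by unfold_locales (rule assms(2))
  let ?q = "card (carrier R)"
  let ?P = "\<lambda>k. l * (?q - 1) < ?q ^ k"
  have seed: "seed_number R n T = (LEAST k. ?P k)"
    using seed_number_eq[OF assms(4)] assms(5) by simp
  \<comment> \<open>This yields the exponent \<open>Suc l\<close> as a witness that the least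
    \<open>k\<close> exists.\<close>
  have "l < ?q ^ l"
    using card_gt_one by (simp add: power_gt_expt)
  then have "l * (?q - 1) < ?q ^ l * ?q"
    by (intro mult_strict_mono) (use card_gt_one in auto)
  then have ex: "?P (Suc l)"
    by (simp add: mult.commute)
  have least: "?q ^ j \<le> l * (?q - 1)" if "j < (LEAST k. ?P k)" for j
    using not_less_Least[OF that] by simp
  show ?thesis
    unfolding repunit_ge_iff[OF card_gt_one] seed
    using log_bounds_of_least[OF card_gt_one _ LeastI[of ?P, OF ex] least] by blast
qed

end
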